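(* Let $M=\mathbb S^1$, let $L=\frac12\frac{\partial^2}{\partial x^2}$, let $V:M\to\mathbb R$ be a Lipschitz function, let $\lambda_V$ be the largest eigenvalue of $L+V$, and let $F>0$ be an associated eigenfunction, so that $(L+V)F=\lambda_V F$. Define the operator $\mathcal L_V$ on $f\in C^2(M)$ by $$\mathcal L_V(f)(x)=\frac{1}{F(x)}(L+V)(Ff)(x)-\lambda_V f(x).$$ Then, for all $f\in C^2(M)$ and $x\in M$, $$\mathcal L_V(f)(x)=\frac12\frac{\partial^2 f}{\partial x^2}(x)+\frac{\partial (\log F)}{\partial x}(x)\,\frac{\partial f}{\partial x}(x),$$ and $\mathcal L_V$ is the infinitesimal generator associated with the semigroup $\{\mathcal P^V_t,\ t\ge 0\}$ on $C(M)$ given by $$\mathcal P^V_t(f)(x)=\mathbb E_x\Big[e^{\int_0^t V(X_r)\,dr}\,\frac{F(X_t)}{e^{\lambda_V t}F(x)}\,f(X_t)\Big];$$ that is, for every $f\in C^2(M)$, $\ \lim_{t\to0^+}\frac{\mathcal P^V_t(f)-f}{t}=\mathcal L_V(f)$ in the supremum norm.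
   Context: $M=\mathbb S^1$ is the interval $[0,1]$ with $0\equiv1$, with the Euclidean metric. $\{X_t,\ t\ge0\}$ is Brownian motion on $M$, i.e. the diffusion with infinitesimal generator $L=\frac12\frac{\partial^2}{\partial x^2}$ acting on $C^2(M)$; $\mathbb E_x$ denotes expectation for this process started at $X_0=x$. The operator $L+V$ acts on $f\in C^2(M)$ by $(L+V)(f)(x)=\frac12 f''(x)+V(x)f(x)$. It is a classical fact that $L+V$ has a largest eigenvalue $\lambda_V$ with a strictly positive eigenfunction $F\in C^2(M)$. *)

theory Defs
  imports "HOL-Probability.Probability"
begin

section \<open>The circle\<close>

quotient_type circle = real / "\<lambda>x y. x - y \<in> \<int>"
proof (rule equivpI)
  show "reflp (\<lambda>x y::real. x - y \<in> \<int>)"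
    by (simp add: reflp_def)
  show "symp (\<lambda>x y::real. x - y \<in> \<int>)"
    unfolding symp_def by (metis Ints_minus minus_diff_eq)
  show "transp (\<lambda>x y::real. x - y \<in> \<int>)"
    unfolding transp_def by (metis Ints_add add_diff_cancel diff_add_cancel add_diff_eq)
qed

lift_definition to_circle :: "real \<Rightarrow> circle" is "\<lambda>x. x" .

lemma round_add_int: "round (x + of_int n) = round (x::real) + n"
  unfolding round_def by (metis add.assoc add.commute floor_add_int)

lemma dist_int_triangle:
  fixes x y :: real
  shows "\<bar>(x + y) - of_int (round (x + y))\<bar>
           \<le> \<bar>x - of_int (round x)\<bar> + \<bar>y - of_int (round y)\<bar>"
proof -
  have "\<bar>(x + y) - of_int (round (x + y))\<bar> \<le> \<bar>(x + y) - of_int (round x + round y)\<bar>"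
    by (rule round_diff_minimal)
  also have "\<dots> \<le> \<bar>x - of_int (round x)\<bar> + \<bar>y - of_int (round y)\<bar>"
    by simp
  finally show ?thesis .
qed

lemma dist_int_minus:
  "\<bar>- x - of_int (round (- x))\<bar> = \<bar>x - of_int (round (x::real))\<bar>"
proof (rule antisym)
  show "\<bar>- x - of_int (round (- x))\<bar> \<le> \<bar>x - of_int (round x)\<bar>"
    using round_diff_minimal[of "- x" "- round x"] by (simp add: abs_minus_commute)
  show "\<bar>x - of_int (round x)\<bar> \<le> \<bar>- x - of_int (round (- x))\<bar>"
    using round_diff_minimal[of x "- round (- x)"] by (simp add: abs_minus_commute)
qed

instantiation circle :: metric_space
begin

text \<open>The Euclidean metric of $[0,1]$ with the endpoints identified: the distance of
  $x - y$ to the nearest integer.\<close>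

lift_definition dist_circle :: "circle \<Rightarrow> circle \<Rightarrow> real"
  is "\<lambda>x y. \<bar>(x - y) - of_int (round (x - y))\<bar>"
proof -
  fix a a' b b' :: real
  assume "a - a' \<in> \<int>" "b - b' \<in> \<int>"
  then have "(a - a') - (b - b') \<in> \<int>" by (rule Ints_diff)
  then obtain n where "(a - a') - (b - b') = of_int n" by (rule Ints_cases)
  then have *: "a - b = (a' - b') + of_int n" by simp
  show "\<bar>(a - b) - of_int (round (a - b))\<bar> = \<bar>(a' - b') - of_int (round (a' - b'))\<bar>"
    unfolding * round_add_int by simp
qed

definition uniformity_circle :: "(circle \<times> circle) filter"
  where "uniformity_circle = (INF e\<in>{0 <..}. principal {(x, y). dist x y < e})"

definition open_circle :: "circle set \<Rightarrow> bool"
  where "open_circle U \<longleftrightarrow>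
           (\<forall>x\<in>U. eventually (\<lambda>(x', y). x' = x \<longrightarrow> y \<in> U) uniformity)"

instance
proof
  fix x y z :: circle
  show "uniformity = (INF e\<in>{0 <..}. principal {(x, y). dist x (y::circle) < e})"
    by (rule uniformity_circle_def)
  show "open U = (\<forall>x\<in>U. eventually (\<lambda>(x', y). x' = x \<longrightarrow> y \<in> U) uniformity)"
    for U :: "circle set"
    by (rule open_circle_def)
  show "(dist x y = 0) = (x = y)"
  proof transfer
    fix x y :: real
    show "(\<bar>(x - y) - of_int (round (x - y))\<bar> = 0) = (x - y \<in> \<int>)"
      by (auto elim!: Ints_cases) (metis Ints_of_int)
  qed
  show "dist x y \<le> dist x z + dist y z"
  proof transfer
    fix x y z :: real
    show "\<bar>(x - y) - of_int (round (x - y))\<bar>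
            \<le> \<bar>(x - z) - of_int (round (x - z))\<bar> + \<bar>(y - z) - of_int (round (y - z))\<bar>"
      using dist_int_triangle[of "x - z" "- (y - z)"] dist_int_minus[of "y - z"] by simp
  qed
qed

end

section \<open>Differential operators\<close>

lemma deriv_shift_periodic:
  fixes g :: "real \<Rightarrow> real"
  assumes "\<And>u. g (u + c) = g u"
  shows "deriv g (x + c) = deriv g x"
proof -
  have "(g has_field_derivative D) (at (x + c)) = (g has_field_derivative D) (at x)" for D
    using DERIV_shift[of g D x c] assms by simp
  then show ?thesis unfolding deriv_def by simp
qed

lift_definition circle_deriv :: "(circle \<Rightarrow> real) \<Rightarrow> circle \<Rightarrow> real"
  is "\<lambda>f x. deriv (\<lambda>u. f (to_circle u)) x"
proof -
  fix f :: "circle \<Rightarrow> real" and x y :: real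
  assume "x - y \<in> \<int>"
  then obtain n where n: "x - y = of_int n" by (rule Ints_cases)
  have "to_circle (u + of_int n) = to_circle u" for u
    by transfer simp
  then have "deriv (\<lambda>u. f (to_circle u)) (y + of_int n) = deriv (\<lambda>u. f (to_circle u)) y"
    by (intro deriv_shift_periodic) simp
  moreover have "x = y + of_int n" using n by simp
  ultimately show "deriv (\<lambda>u. f (to_circle u)) x = deriv (\<lambda>u. f (to_circle u)) y"
    by simp
qed

definition C2_circle :: "(circle \<Rightarrow> real) set" where
  "C2_circle = {f. (\<forall>u. (\<lambda>u. f (to_circle u)) differentiable (at u)) \<and>
                   (\<forall>u. deriv (\<lambda>u. f (to_circle u)) differentiable (at u)) \<and>
                   continuous_on UNIV (deriv (deriv (\<lambda>u. f (to_circle u))))}"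

definition genL :: "(circle \<Rightarrow> real) \<Rightarrow> circle \<Rightarrow> real" where
  "genL f x = 1 / 2 * circle_deriv (circle_deriv f) x"

definition schroedinger :: "(circle \<Rightarrow> real) \<Rightarrow> (circle \<Rightarrow> real) \<Rightarrow> circle \<Rightarrow> real" where
  "schroedinger V f x = genL f x + V x * f x"

definition is_eigenfunction :: "(circle \<Rightarrow> real) \<Rightarrow> real \<Rightarrow> (circle \<Rightarrow> real) \<Rightarrow> bool" where
  "is_eigenfunction V \<mu> f \<longleftrightarrow>
     f \<in> C2_circle \<and> (\<exists>x. f x \<noteq> 0) \<and> (\<forall>x. schroedinger V f x = \<mu> * f x)"

text \<open>$L + V$ is symmetric in $L^2(M)$, so all its eigenvalues are real.\<close>

definition is_largest_eigenvalue :: "(circle \<Rightarrow> real) \<Rightarrow> real \<Rightarrow> bool" where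
  "is_largest_eigenvalue V lam \<longleftrightarrow>
     (\<exists>f. is_eigenfunction V lam f) \<and> (\<forall>\<mu> f. is_eigenfunction V \<mu> f \<longrightarrow> \<mu> \<le> lam)"

definition LV :: "(circle \<Rightarrow> real) \<Rightarrow> real \<Rightarrow> (circle \<Rightarrow> real) \<Rightarrow> (circle \<Rightarrow> real) \<Rightarrow> circle \<Rightarrow> real" where
  "LV V lam F f x = 1 / F x * schroedinger V (\<lambda>y. F y * f y) x - lam * f x"

section \<open>Semigroups on $C(M)$ and generators\<close>

text \<open>Operators on $C(M)$ are represented by total maps on functions, of which only the values
  at continuous functions and at times $t \ge 0$ matter.\<close>

definition C_semigroup :: "(real \<Rightarrow> (circle \<Rightarrow> real) \<Rightarrow> circle \<Rightarrow> real) \<Rightarrow> bool" where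
  "C_semigroup T \<longleftrightarrow>
     (\<forall>t\<ge>0. \<forall>f. continuous_on UNIV f \<longrightarrow> continuous_on UNIV (T t f)) \<and>
     (\<forall>t\<ge>0. \<forall>a b f g. continuous_on UNIV f \<longrightarrow> continuous_on UNIV g \<longrightarrow>
        T t (\<lambda>x. a * f x + b * g x) = (\<lambda>x. a * T t f x + b * T t g x)) \<and>
     (\<forall>t\<ge>0. \<exists>K. \<forall>f c. continuous_on UNIV f \<longrightarrow> (\<forall>x. \<bar>f x\<bar> \<le> c) \<longrightarrow> (\<forall>x. \<bar>T t f x\<bar> \<le> K * c)) \<and>
     (\<forall>f. continuous_on UNIV f \<longrightarrow> T 0 f = f) \<and>
     (\<forall>s\<ge>0. \<forall>t\<ge>0. \<forall>f. continuous_on UNIV f \<longrightarrow> T (s + t) f = T s (T t f)) \<and>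
     (\<forall>f. continuous_on UNIV f \<longrightarrow> uniform_limit UNIV (\<lambda>t. T t f) f (at_right 0))"

definition has_generator ::
  "(real \<Rightarrow> (circle \<Rightarrow> real) \<Rightarrow> circle \<Rightarrow> real) \<Rightarrow> ((circle \<Rightarrow> real) \<Rightarrow> circle \<Rightarrow> real) \<Rightarrow> bool" where
  "has_generator T A \<longleftrightarrow>
     (\<forall>f\<in>C2_circle. uniform_limit UNIV (\<lambda>t x. (T t f x - f x) / t) (A f) (at_right 0))"

section \<open>Brownian motion on the circle\<close>

definition transition ::
  "(real \<Rightarrow> 'w \<Rightarrow> circle) \<Rightarrow> (circle \<Rightarrow> 'w measure) \<Rightarrow> real \<Rightarrow> (circle \<Rightarrow> real) \<Rightarrow> circle \<Rightarrow> real" where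
  "transition X Pr t f x = (\<integral>w. f (X t w) \<partial>Pr x)"

text \<open>A diffusion is a Feller Markov process with continuous paths; \<open>Pr x\<close> is the law under which
  the process starts at \<open>x\<close>. Only times $t \ge 0$ are constrained.\<close>

locale circle_diffusion = filtration \<Omega> \<F>
  for \<Omega> :: "'w set" and \<F> :: "real \<Rightarrow> 'w measure" +
  fixes X :: "real \<Rightarrow> 'w \<Rightarrow> circle" and Pr :: "circle \<Rightarrow> 'w measure"
  assumes prob: "\<And>x. prob_space (Pr x)"
    and subalg: "\<And>x t. t \<ge> 0 \<Longrightarrow> subalgebra (Pr x) (\<F> t)"
    and adapted: "\<And>t. t \<ge> 0 \<Longrightarrow> X t \<in> borel_measurable (\<F> t)"
    and cont_paths: "\<And>w. w \<in> \<Omega> \<Longrightarrow> continuous_on {0..} (\<lambda>t. X t w)"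
    and start: "\<And>x. AE w in Pr x. X 0 w = x"
    and markov: "\<And>x s t f. s \<ge> 0 \<Longrightarrow> t \<ge> 0 \<Longrightarrow> continuous_on UNIV f \<Longrightarrow>
      AE w in Pr x. real_cond_exp (Pr x) (\<F> s) (\<lambda>w. f (X (s + t) w)) w
                      = transition X Pr t f (X s w)"
    and feller: "\<And>t f. t \<ge> 0 \<Longrightarrow> continuous_on UNIV f \<Longrightarrow>
      continuous_on UNIV (transition X Pr t f)"

locale circle_brownian_motion = circle_diffusion +
  assumes generator: "has_generator (transition X Pr) genL"

definition PV ::
  "(real \<Rightarrow> 'w \<Rightarrow> circle) \<Rightarrow> (circle \<Rightarrow> 'w measure) \<Rightarrow> (circle \<Rightarrow> real) \<Rightarrow> real \<Rightarrow> (circle \<Rightarrow> real)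
     \<Rightarrow> real \<Rightarrow> (circle \<Rightarrow> real) \<Rightarrow> circle \<Rightarrow> real" where
  "PV X Pr V lam F t f x =
     (\<integral>w. exp (integral {0..t} (\<lambda>r. V (X r w))) * (F (X t w) / (exp (lam * t) * F x)) * f (X t w)
        \<partial>Pr x)"

end

theory Submission
  imports Defs
begin

text \<open>
  Put $T_t g(x) = \mathbb E_x[e^{\int_0^t V(X_r)\,dr} g(X_t)]$, so that
  $\mathcal P^V_t f = e^{-\lambda_V t} F^{-1} T_t(F f)$; it suffices to show that $T$ is a semigroup on
  $C(M)$ with generator $L + V$. Applying the generator to $\cos 2\pi x$ and $\sin 2\pi x$ gives, with
  the Markov property, $\mathbb E_x |g(X_{s+h}) - g(X_s)| \to 0$ as $h \to 0$, uniformly in $x$ and $s$,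
  for every continuous $g$. Hence $T_t g$ is the uniform limit of $S_{t/n}^n g$, where
  $S_h g(x) = \mathbb E_x[e^{h V(X_h)} g(X_h)]$: as $S_h$ preserves $C(M)$, so does $T_t$, and the
  semigroup property follows by dominated convergence. Finally
  $T_t g - \mathbb E_x[g(X_t)] = t V(x) \mathbb E_x[g(X_t)] + o(t)$ uniformly in $x$.
\<close>

section \<open>Calculus on the circle\<close>

text \<open>So the time integral in the exponent is always reached through Riemann sums over
  finitely many sampled positions: they yield its adaptedness, the exchange of expectation with the
  time integral, and a form of the exponential to which the Markov property applies. The generator
  acts on C^2 functions, while the circle distance to a point is not differentiable there. Its
  replacement 1 - cos(2 pi d(x,y)) is half the squared chord between two points of the unit circle.
  By the addition formula it splits into products of a function of x and a function of y, so
  conditioning at time s leaves an expression in X_s alone; a bound uniform in that position is then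
  uniform in s and in the starting point. The drift (log F)' arises from the cross term of (F f)'',
  and the terms without derivatives of f cancel by the eigenvalue equation.\<close>

lemma to_circle_cases: obtains u where "x = to_circle u"
proof -
  have "\<exists>u. x = to_circle u" by transfer (metis Ints_0 diff_self)
  then show ?thesis using that by blast
qed

lemma dist_to_circle:
  "dist (to_circle x) (to_circle y) = \<bar>(x - y) - of_int (round (x - y))\<bar>"
  by transfer simp

lemma dist_to_circle_le: "dist (to_circle x) (to_circle y) \<le> \<bar>x - y\<bar>"
  unfolding dist_to_circle using round_diff_minimal[of "x - y" 0] by simp

lemma to_circle_add_int: "to_circle (u + of_int n) = to_circle u"
  by transfer simp

lemma continuous_on_to_circle: "continuous_on UNIV to_circle"
proof (rule continuous_on_iff[THEN iffD2], intro ballI allI impI)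
  fix x e :: real assume "0 < e"
  then show "\<exists>d>0. \<forall>x'\<in>UNIV. dist x' x < d \<longrightarrow> dist (to_circle x') (to_circle x) < e"
    by (intro exI[of _ e]) (auto simp: dist_real_def intro: le_less_trans[OF dist_to_circle_le])
qed

lemma compact_UNIV_circle: "compact (UNIV :: circle set)"
proof -
  have "to_circle ` {0..1} = UNIV"
  proof (intro equalityI subsetI UNIV_I)
    fix x :: circle
    obtain u where u: "x = to_circle u" by (rule to_circle_cases)
    have "x = to_circle (frac u)"
      using to_circle_add_int[of "frac u" "floor u"] u by (simp add: frac_def)
    then show "x \<in> to_circle ` {0..1}"
      using frac_ge_0[of u] frac_lt_1[of u] by (intro image_eqI[of _ _ "frac u"]) auto
  qed
  then show ?thesis
    by (metis compact_Icc compact_continuous_image continuous_on_subset[OF continuous_on_to_circle] subset_UNIV)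
qed

lemma circle_continuous_bounded_range:
  fixes f :: "circle \<Rightarrow> real"
  assumes "continuous_on UNIV f"
  shows "bounded (range f)"
  using compact_imp_bounded[OF compact_continuous_image[OF assms compact_UNIV_circle]] .

lemma circle_continuous_bounded:
  fixes f :: "circle \<Rightarrow> real"
  assumes "continuous_on UNIV f"
  obtains B where "B > 0" "\<And>x. \<bar>f x\<bar> \<le> B"
proof -
  obtain B where "B > 0" "\<And>x. \<bar>f x\<bar> \<le> B"
    using circle_continuous_bounded_range[OF assms] unfolding bounded_pos by auto
  then show ?thesis by (rule that)
qed

text \<open>Points near \<open>to_circle a\<close> have representatives near \<open>a\<close>, so
  continuity of the periodic lift at \<open>a\<close> carries over.\<close>

lemma continuous_on_circleI:
  fixes f :: "circle \<Rightarrow> real"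
  assumes "continuous_on UNIV (\<lambda>u. f (to_circle u))"
  shows "continuous_on UNIV f"
proof (rule continuous_on_iff[THEN iffD2], intro ballI allI impI)
  fix x :: circle and e :: real assume e: "0 < e"
  obtain a where a: "x = to_circle a" by (rule to_circle_cases)
  obtain d where d: "d > 0" "\<And>b. dist b a < d \<Longrightarrow> dist (f (to_circle b)) (f (to_circle a)) < e"
    using assms e unfolding continuous_on_iff by blast
  have "dist (f y) (f x) < e" if "dist y x < d" for y
  proof -
    obtain b where b: "y = to_circle b" by (rule to_circle_cases)
    \<comment> \<open>Shifting by the nearest integer makes the distance from \<open>b'\<close> to
      \<open>a\<close> on the line equal to the circle distance.\<close>
    define b' where "b' = b + of_int (- round (b - a))"
    have "y = to_circle b'" unfolding b b'_def to_circle_add_int ..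
    moreover have "dist b' a < d"
      using that by (simp add: a b b'_def dist_to_circle dist_real_def algebra_simps)
    ultimately show ?thesis using d(2)[of b'] a by simp
  qed
  then show "\<exists>d>0. \<forall>x'\<in>UNIV. dist x' x < d \<longrightarrow> dist (f x') (f x) < e"
    using d(1) by blast
qed

section \<open>Derivatives and C^2 functions on the circle\<close>

lemma circle_deriv_to_circle: "circle_deriv f (to_circle u) = deriv (\<lambda>u. f (to_circle u)) u"
  by (simp add: to_circle.abs_eq circle_deriv.abs_eq)

lemma circle_deriv_eqI:
  assumes "((\<lambda>u. f (to_circle u)) has_real_derivative D) (at u)"
  shows "circle_deriv f (to_circle u) = D"
  using assms by (simp add: circle_deriv_to_circle DERIV_imp_deriv)

text \<open>The first derivative is required at every point because it has to be identified as a
  function before it can be differentiated.\<close>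

lemma circle_deriv2_eqI:
  assumes "\<And>u. ((\<lambda>u. f (to_circle u)) has_real_derivative f' u) (at u)"
    and "(f' has_real_derivative D) (at u)"
  shows "circle_deriv (circle_deriv f) (to_circle u) = D"
proof (rule circle_deriv_eqI)
  have "(\<lambda>u. circle_deriv f (to_circle u)) = f'"
    using assms(1) by (intro ext circle_deriv_eqI)
  then show "((\<lambda>u. circle_deriv f (to_circle u)) has_real_derivative D) (at u)"
    using assms(2) by simp
qed

lemma C2_circleI:
  assumes f': "\<And>u. ((\<lambda>u. f (to_circle u)) has_real_derivative f' u) (at u)"
    and f'': "\<And>u. (f' has_real_derivative f'' u) (at u)"
    and "continuous_on UNIV f''"
  shows "f \<in> C2_circle"
proof -
  have "deriv (\<lambda>u. f (to_circle u)) = f'" "deriv f' = f''"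
    using f' f'' by (auto intro: DERIV_imp_deriv)
  then show ?thesis
    using assms unfolding C2_circle_def
    by (auto simp: real_differentiable_def)
qed

lemma C2_circleE:
  assumes "f \<in> C2_circle"
  obtains f' f'' where
    "\<And>u. ((\<lambda>u. f (to_circle u)) has_real_derivative f' u) (at u)"
    "\<And>u. (f' has_real_derivative f'' u) (at u)"
    "continuous_on UNIV f''"
proof
  show "((\<lambda>u. f (to_circle u)) has_real_derivative deriv (\<lambda>u. f (to_circle u)) u) (at u)" for u
    using assms unfolding C2_circle_def
    by (auto simp: DERIV_deriv_iff_real_differentiable)
  show "(deriv (\<lambda>u. f (to_circle u)) has_real_derivative deriv (deriv (\<lambda>u. f (to_circle u))) u) (at u)" for u
    using assms unfolding C2_circle_def
    by (auto simp: DERIV_deriv_iff_real_differentiable)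
  show "continuous_on UNIV (deriv (deriv (\<lambda>u. f (to_circle u))))"
    using assms unfolding C2_circle_def by auto
qed

lemma C2_circle_continuous:
  assumes "f \<in> C2_circle"
  shows "continuous_on UNIV f"
proof -
  obtain f' where "\<And>u. ((\<lambda>u. f (to_circle u)) has_real_derivative f' u) (at u)"
    using assms by (rule C2_circleE) blast
  then show ?thesis
    by (intro continuous_on_circleI continuous_at_imp_continuous_on ballI DERIV_isCont)
qed

lemma genL_continuous:
  assumes "f \<in> C2_circle"
  shows "continuous_on UNIV (genL f)"
proof -
  obtain f' f'' where f: "\<And>u. ((\<lambda>u. f (to_circle u)) has_real_derivative f' u) (at u)"
    "\<And>u. (f' has_real_derivative f'' u) (at u)" "continuous_on UNIV f''"
    using assms by (rule C2_circleE) blast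
  have "(\<lambda>u. genL f (to_circle u)) = (\<lambda>u. 1 / 2 * f'' u)"
    unfolding genL_def by (intro ext arg_cong2[of _ _ _ _ "(*)"] refl circle_deriv2_eqI[OF f(1,2)])
  then show ?thesis
    using f(3) by (intro continuous_on_circleI) (simp only: continuous_on_mult_left)
qed

lemma C2_circle_mult:
  assumes "f \<in> C2_circle" "g \<in> C2_circle"
  shows "(\<lambda>x. f x * g x) \<in> C2_circle"
    and "circle_deriv (circle_deriv (\<lambda>x. f x * g x)) x
           = circle_deriv (circle_deriv f) x * g x + 2 * circle_deriv f x * circle_deriv g x
             + f x * circle_deriv (circle_deriv g) x"
proof -
  obtain f' f'' where f: "\<And>u. ((\<lambda>u. f (to_circle u)) has_real_derivative f' u) (at u)"
    "\<And>u. (f' has_real_derivative f'' u) (at u)" "continuous_on UNIV f''"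
    using assms(1) by (rule C2_circleE) blast
  obtain g' g'' where g: "\<And>u. ((\<lambda>u. g (to_circle u)) has_real_derivative g' u) (at u)"
    "\<And>u. (g' has_real_derivative g'' u) (at u)" "continuous_on UNIV g''"
    using assms(2) by (rule C2_circleE) blast
  have d1: "((\<lambda>u. f (to_circle u) * g (to_circle u)) has_real_derivative
      f' u * g (to_circle u) + f (to_circle u) * g' u) (at u)" for u
    using DERIV_mult[OF f(1)[of u] g(1)[of u]] by (simp add: algebra_simps)
  have d2: "((\<lambda>u. f' u * g (to_circle u) + f (to_circle u) * g' u) has_real_derivative
      f'' u * g (to_circle u) + 2 * f' u * g' u + f (to_circle u) * g'' u) (at u)" for u
    using DERIV_add[OF DERIV_mult[OF f(2)[of u] g(1)[of u]] DERIV_mult[OF f(1)[of u] g(2)[of u]]]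
    by (simp add: algebra_simps)
  have "continuous_on UNIV f'" "continuous_on UNIV g'"
    using f(2) g(2) by (auto simp: continuous_on_eq_continuous_at intro!: DERIV_isCont)
  moreover have "continuous_on UNIV (\<lambda>u. f (to_circle u))" "continuous_on UNIV (\<lambda>u. g (to_circle u))"
    using f(1) g(1) by (auto simp: continuous_on_eq_continuous_at intro!: DERIV_isCont)
  ultimately show "(\<lambda>x. f x * g x) \<in> C2_circle"
    by (intro C2_circleI[OF d1 d2] continuous_intros f(3) g(3))
  obtain u where u: "x = to_circle u" by (rule to_circle_cases)
  show "circle_deriv (circle_deriv (\<lambda>x. f x * g x)) x
           = circle_deriv (circle_deriv f) x * g x + 2 * circle_deriv f x * circle_deriv g x
             + f x * circle_deriv (circle_deriv g) x"
    unfolding u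
    by (simp add: circle_deriv2_eqI[OF d1 d2] circle_deriv2_eqI[OF f(1,2)] circle_deriv2_eqI[OF g(1,2)]
        circle_deriv_eqI[OF f(1)] circle_deriv_eqI[OF g(1)])
qed

lemma circle_deriv_ln:
  assumes "F \<in> C2_circle" "\<And>x. F x > 0"
  shows "circle_deriv (\<lambda>y. ln (F y)) x = circle_deriv F x / F x"
proof -
  obtain f' f'' where f: "\<And>u. ((\<lambda>u. F (to_circle u)) has_real_derivative f' u) (at u)"
    using assms(1) by (rule C2_circleE) blast
  obtain u where u: "x = to_circle u" by (rule to_circle_cases)
  have "((\<lambda>u. ln (F (to_circle u))) has_real_derivative f' u / F (to_circle u)) (at u)"
    by (rule derivative_eq_intros f assms(2) refl)+ simp
  then show ?thesis
    unfolding u by (simp add: circle_deriv_eqI[OF f] circle_deriv_eqI)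
qed

text \<open>By the product rule, the terms of (L+V)(F f) in which \<open>f\<close> is not
  differentiated add up to f (L+V)F = lam F f, which the subtraction in \<open>LV\<close> removes.
  The factor 1/2 turns the cross term 2 F' f' into F' f', and division by F produces (log F)'
  f'.\<close>

lemma LV_eq:
  assumes "is_eigenfunction V lam F" "\<And>x. F x > 0" "f \<in> C2_circle"
  shows "LV V lam F f x = 1 / 2 * circle_deriv (circle_deriv f) x
            + circle_deriv (\<lambda>y. ln (F y)) x * circle_deriv f x"
proof -
  have F: "F \<in> C2_circle" and eq: "schroedinger V F x = lam * F x"
    using assms(1) unfolding is_eigenfunction_def by auto
  have *: "schroedinger V (\<lambda>y. F y * f y) x
      = schroedinger V F x * f x + circle_deriv F x * circle_deriv f x
        + F x * (1 / 2 * circle_deriv (circle_deriv f) x)"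
    unfolding schroedinger_def genL_def C2_circle_mult(2)[OF F assms(3)]
    by (simp add: algebra_simps)
  show ?thesis
    unfolding LV_def * eq circle_deriv_ln[OF F assms(2)]
    using assms(2)[of x] by (simp add: field_simps)
qed

section \<open>Trigonometric functions and the chordal gap\<close>

lift_definition circle_cos :: "circle \<Rightarrow> real" is "\<lambda>u. cos (2 * pi * u)"
proof -
  fix x y :: real assume "x - y \<in> \<int>"
  then obtain n where "x - y = of_int n" by (rule Ints_cases)
  then have "2 * pi * x = 2 * pi * y + 2 * pi * of_int n" by (simp add: algebra_simps)
  then show "cos (2 * pi * x) = cos (2 * pi * y)" by (simp add: cos_add)
qed

lift_definition circle_sin :: "circle \<Rightarrow> real" is "\<lambda>u. sin (2 * pi * u)"
proof -
  fix x y :: real assume "x - y \<in> \<int>"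
  then obtain n where "x - y = of_int n" by (rule Ints_cases)
  then have "2 * pi * x = 2 * pi * y + 2 * pi * of_int n" by (simp add: algebra_simps)
  then show "sin (2 * pi * x) = sin (2 * pi * y)" by (simp add: sin_add)
qed

lemma circle_cos_to_circle: "circle_cos (to_circle u) = cos (2 * pi * u)"
  by transfer simp

lemma circle_sin_to_circle: "circle_sin (to_circle u) = sin (2 * pi * u)"
  by transfer simp

lemma circle_cos_C2: "circle_cos \<in> C2_circle"
proof (rule C2_circleI)
  show "((\<lambda>u. circle_cos (to_circle u)) has_real_derivative - (2 * pi * sin (2 * pi * u))) (at u)" for u
    unfolding circle_cos_to_circle by (rule derivative_eq_intros refl)+ simp
  show "((\<lambda>u. - (2 * pi * sin (2 * pi * u))) has_real_derivative
      - (2 * pi * (2 * pi) * cos (2 * pi * u))) (at u)" for u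
    by (rule derivative_eq_intros refl)+ simp
qed (intro continuous_intros)

lemma circle_sin_C2: "circle_sin \<in> C2_circle"
proof (rule C2_circleI)
  show "((\<lambda>u. circle_sin (to_circle u)) has_real_derivative 2 * pi * cos (2 * pi * u)) (at u)" for u
    unfolding circle_sin_to_circle by (rule derivative_eq_intros refl)+ simp
  show "((\<lambda>u. 2 * pi * cos (2 * pi * u)) has_real_derivative
      - (2 * pi * (2 * pi) * sin (2 * pi * u))) (at u)" for u
    by (rule derivative_eq_intros refl)+ simp
qed (intro continuous_intros)

text \<open>The left side is the inner product of two unit vectors in the plane; up to sign and full
  turns, the angle between them is 2 pi times the distance.\<close>

lemma circle_cos_sin_dist:
  "circle_cos x * circle_cos y + circle_sin x * circle_sin y = cos (2 * pi * dist x y)"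
proof -
  obtain u where u: "x = to_circle u" by (rule to_circle_cases)
  obtain v where v: "y = to_circle v" by (rule to_circle_cases)
  define r where "r = round (u - v)"
  have "cos (2 * pi * \<bar>a\<bar>) = cos (2 * pi * a)" for a :: real
    by (cases "a \<ge> 0") simp_all
  then have "cos (2 * pi * dist x y) = cos (2 * pi * ((u - v) - of_int r))"
    unfolding u v dist_to_circle r_def .
  also have "2 * pi * ((u - v) - of_int r) = (2 * pi * u - 2 * pi * v) - 2 * pi * of_int r"
    by (simp add: algebra_simps)
  also have "cos \<dots> = cos (2 * pi * u - 2 * pi * v)"
    by (simp only: cos_diff) simp
  finally show ?thesis
    unfolding u v circle_cos_to_circle circle_sin_to_circle by (simp add: cos_diff)
qed

text \<open>This keeps 2 pi times a distance in [0, pi], where the cosine is decreasing, so that the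
  gap grows with the distance.\<close>

lemma dist_circle_le_half: "dist x (y :: circle) \<le> 1 / 2"
proof -
  obtain u where u: "x = to_circle u" by (rule to_circle_cases)
  obtain v where v: "y = to_circle v" by (rule to_circle_cases)
  show ?thesis
    unfolding u v dist_to_circle using of_int_round_abs_le[of "u - v"] by (simp add: abs_minus_commute)
qed

text \<open>The expectation of this substitute for the squared distance can be bounded with the
  generator: given its first argument, it is a linear combination of functions in $C^2(M)$.\<close>

definition circle_gap :: "circle \<Rightarrow> circle \<Rightarrow> real" where
  "circle_gap x y = 1 - (circle_cos x * circle_cos y + circle_sin x * circle_sin y)"

lemma circle_gap_nonneg: "0 \<le> circle_gap x y"
  unfolding circle_gap_def circle_cos_sin_dist by simp

lemma abs_circle_cos_le: "\<bar>circle_cos y\<bar> \<le> 1"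
  by (rule to_circle_cases[of y]) (simp add: circle_cos_to_circle)

lemma abs_circle_sin_le: "\<bar>circle_sin y\<bar> \<le> 1"
  by (rule to_circle_cases[of y]) (simp add: circle_sin_to_circle)

lemma circle_gap_self: "circle_gap y y = 0"
  unfolding circle_gap_def circle_cos_sin_dist by simp

lemma circle_gap_le: "circle_gap x y \<le> 2"
  unfolding circle_gap_def circle_cos_sin_dist by (metis cos_ge_minus_one diff_left_mono diff_minus_eq_add one_add_one)

text \<open>Nearby points are covered by \<open>e\<close> through uniform continuity. For points at
  distance at least \<open>d'\<close> the gap is bounded below by some \<open>m > 0\<close>, and a
  multiple of it dominates the total oscillation \<open>2 * B\<close>.\<close>

lemma continuous_le_circle_gap:
  fixes f :: "circle \<Rightarrow> real"
  assumes "continuous_on UNIV f" "e > 0"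
  obtains C where "C \<ge> 0" "\<And>x y. \<bar>f y - f x\<bar> \<le> e + C * circle_gap x y"
proof -
  obtain B where B: "B > 0" "\<And>x. \<bar>f x\<bar> \<le> B"
    using assms(1) by (rule circle_continuous_bounded) blast
  have "uniformly_continuous_on UNIV f"
    using assms(1) compact_UNIV_circle by (rule compact_uniformly_continuous)
  then obtain d where d: "d > 0" "\<And>x y. dist y x < d \<Longrightarrow> \<bar>f y - f x\<bar> < e"
    using assms(2) unfolding uniformly_continuous_on_def dist_real_def by (metis UNIV_I)
  \<comment> \<open>The cap 1/2 keeps \<open>2 * pi * d'\<close> in [0, pi], as the monotonicity of
    the cosine requires.\<close>
  define d' where "d' = min d (1 / 2)"
  have d': "0 < d'" "d' \<le> d" "d' \<le> 1 / 2" using d(1) by (auto simp: d'_def)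
  define m where "m = 1 - cos (2 * pi * d')"
  have "cos (2 * pi * d') < cos 0"
    using d' by (intro cos_monotone_0_pi) (auto simp: field_simps)
  then have m: "m > 0" by (simp add: m_def)
  have "\<bar>f y - f x\<bar> \<le> e + 2 * B / m * circle_gap x y" for x y
  proof (cases "dist x y < d'")
    case True
    then have "\<bar>f y - f x\<bar> < e" using d d' by (simp add: dist_commute)
    moreover have "0 \<le> 2 * B / m * circle_gap x y"
      using B m circle_gap_nonneg by simp
    ultimately show ?thesis by linarith
  next
    case False
    have "cos (2 * pi * dist x y) \<le> cos (2 * pi * d')"
      using d' False dist_circle_le_half[of x y]
      by (intro cos_monotone_0_pi_le) (auto simp: field_simps)
    then have "m \<le> circle_gap x y" by (simp add: m_def circle_gap_def circle_cos_sin_dist)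
    then have "2 * B \<le> 2 * B / m * circle_gap x y"
      using m B(1) by (simp add: field_simps)
    moreover have "\<bar>f y - f x\<bar> \<le> 2 * B" using B(2)[of x] B(2)[of y] by linarith
    ultimately show ?thesis using assms(2) by linarith
  qed
  then show ?thesis using that[of "2 * B / m"] B m by simp
qed

section \<open>Riemann sums and exponential estimates\<close>

lemma integral_blocks:
  fixes g :: "real \<Rightarrow> real"
  assumes "continuous_on {a..} g" "h \<ge> 0"
  shows "integral {a..a + real n * h} g
           = (\<Sum>k<n. integral {a + real k * h..a + real k * h + h} g)"
proof (induction n)
  case (Suc n)
  have "integral {a..a + real (Suc n) * h} g
      = integral {a..a + real n * h} g + integral {a + real n * h..a + real (Suc n) * h} g"
    using assms(2)
    by (intro Henstock_Kurzweil_Integration.integral_combine[symmetric]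
          integrable_continuous_interval continuous_on_subset[OF assms(1)])
       (auto simp: algebra_simps)
  moreover have "a + real (Suc n) * h = a + real n * h + h" by (simp add: algebra_simps)
  ultimately have "integral {a..a + real (Suc n) * h} g
      = integral {a..a + real n * h} g + integral {a + real n * h..a + real n * h + h} g" by metis
  then show ?case unfolding Suc sum.lessThan_Suc .
qed simp

lemma integral_minus_const_le:
  fixes g :: "real \<Rightarrow> real"
  assumes "continuous_on {a..a + h} g" "h \<ge> 0"
    and "\<And>r. r \<in> {a..a + h} \<Longrightarrow> \<bar>g r - c\<bar> \<le> e"
  shows "\<bar>integral {a..a + h} g - h * c\<bar> \<le> h * e"
proof -
  have "integral {a..a + h} (\<lambda>r. g r - c) = integral {a..a + h} g - h * c"
    using assms(2)
    by (subst Henstock_Kurzweil_Integration.integral_diff)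
       (auto intro!: integrable_continuous_interval assms(1))
  moreover have "norm (integral {a..a + h} (\<lambda>r. g r - c)) \<le> e * (a + h - a)"
    using assms by (intro integral_bound continuous_intros) auto
  ultimately show ?thesis by (simp add: mult.commute)
qed

text \<open>Uniform continuity on the compact interval bounds the error on each block by its length
  times \<open>e'\<close>. The samples are right endpoints, and \<open>Suc n\<close> blocks avoid
  division by zero.\<close>

lemma riemann_sum_tendsto:
  fixes g :: "real \<Rightarrow> real"
  assumes g: "continuous_on {a..} g" and "t \<ge> 0"
  shows "(\<lambda>n. t / real (Suc n) * (\<Sum>k<Suc n. g (a + real (Suc k) * (t / real (Suc n)))))
           \<longlonglongrightarrow> integral {a..a + t} g"
proof (rule LIMSEQ_I)
  fix e :: real assume "e > 0"
  \<comment> \<open>The summand 1 keeps the quotient meaningful for \<open>t = 0\<close> and makes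
    \<open>t * e' < e\<close> strict.\<close>
  define e' where "e' = e / (t + 1)"
  have e': "e' > 0" "t * e' < e" using \<open>e > 0\<close> \<open>t \<ge> 0\<close> by (auto simp: e'_def field_simps)
  have "uniformly_continuous_on {a..a + t} g"
    by (intro compact_uniformly_continuous continuous_on_subset[OF g]) auto
  then obtain d where d: "d > 0"
    "\<And>r r'. r \<in> {a..a + t} \<Longrightarrow> r' \<in> {a..a + t} \<Longrightarrow> \<bar>r' - r\<bar> < d \<Longrightarrow> \<bar>g r' - g r\<bar> < e'"
    using e'(1) unfolding uniformly_continuous_on_def dist_real_def by metis
  obtain N where N: "t / d < real N" using reals_Archimedean2 by blast
  show "\<exists>N. \<forall>n\<ge>N. norm (t / real (Suc n) * (\<Sum>k<Suc n. g (a + real (Suc k) * (t / real (Suc n))))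
      - integral {a..a + t} g) < e"
  proof (intro exI[of _ N] allI impI)
    fix n assume n: "n \<ge> N"
    define h where "h = t / real (Suc n)"
    have nh: "real (Suc n) * h = t" and h0: "h \<ge> 0" using \<open>t \<ge> 0\<close> by (auto simp: h_def)
    have "t < real N * d" using N d(1) by (simp add: field_simps)
    also have "\<dots> \<le> real (Suc n) * d" using n d(1) by (intro mult_right_mono) auto
    finally have h: "h < d" by (simp add: h_def field_simps)
    have block: "\<bar>integral {a + real k * h..a + real k * h + h} g - h * g (a + real (Suc k) * h)\<bar> \<le> h * e'"
      if "k < Suc n" for k
    proof (rule integral_minus_const_le)
      have k: "real k * h \<ge> 0" "real k * h + h \<le> t"
      proof -
        have "real (Suc k) * h \<le> real (Suc n) * h"
          using that h0 by (intro mult_right_mono) auto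
        then show "real k * h + h \<le> t" unfolding nh by (simp add: algebra_simps)
      qed (use h0 in simp)
      show "continuous_on {a + real k * h..a + real k * h + h} g"
        by (intro continuous_on_subset[OF g]) (use k in auto)
      show "\<bar>g r - g (a + real (Suc k) * h)\<bar> \<le> e'" if r: "r \<in> {a + real k * h..a + real k * h + h}" for r
      proof (intro less_imp_le d(2))
        have "a + real (Suc k) * h = a + real k * h + h" by (simp add: algebra_simps)
        then show "r \<in> {a..a + t}" "a + real (Suc k) * h \<in> {a..a + t}"
          "\<bar>r - (a + real (Suc k) * h)\<bar> < d"
          using r k h h0 unfolding atLeastAtMost_iff abs_less_iff by linarith+
      qed
    qed (rule h0)
    have "\<bar>h * (\<Sum>k<Suc n. g (a + real (Suc k) * h)) - integral {a..a + t} g\<bar>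
        = \<bar>\<Sum>k<Suc n. integral {a + real k * h..a + real k * h + h} g - h * g (a + real (Suc k) * h)\<bar>"
      unfolding nh[symmetric] integral_blocks[OF g h0] sum_subtractf sum_distrib_left
      by (rule abs_minus_commute)
    also have "\<dots> \<le> (\<Sum>k<Suc n. h * e')"
      by (rule order_trans[OF sum_abs sum_mono]) (use block in auto)
    also have "\<dots> = t * e'" by (simp flip: nh)
    also have "\<dots> < e" by (rule e')
    finally show "norm (t / real (Suc n) * (\<Sum>k<Suc n. g (a + real (Suc k) * (t / real (Suc n))))
      - integral {a..a + t} g) < e" by (simp add: h_def)
  qed
qed

text \<open>For v \<le> u, factoring out exp u leaves 1 - exp (v - u), which is at most u - v by the
  tangent inequality at 0.\<close>

lemma abs_exp_diff_le:
  fixes a b :: real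
  assumes "a \<le> M" "b \<le> M"
  shows "\<bar>exp a - exp b\<bar> \<le> exp M * \<bar>a - b\<bar>"
proof -
  have *: "exp u - exp v \<le> exp M * (u - v)" if "v \<le> u" "u \<le> M" for u v :: real
  proof -
    have "exp u - exp v = exp u * (1 - exp (v - u))" by (simp add: exp_diff field_simps)
    also have "\<dots> \<le> exp u * (u - v)"
      using exp_ge_add_one_self[of "v - u"] by (intro mult_left_mono) (linarith, simp)
    also have "\<dots> \<le> exp M * (u - v)" using that by (intro mult_right_mono) auto
    finally show ?thesis .
  qed
  show ?thesis
  proof (cases "a \<le> b")
    case True
    moreover have "exp a \<le> exp b" using True by simp
    ultimately show ?thesis using *[of a b] assms by simp
  next
    case False
    moreover have "exp b \<le> exp a" using False by simp
    ultimately show ?thesis using *[of b a] assms by simp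
  qed
qed

lemma abs_exp_mult_le:
  fixes a b :: real
  assumes "\<bar>a\<bar> \<le> M" "\<bar>b\<bar> \<le> c"
  shows "\<bar>exp a * b\<bar> \<le> exp M * c"
  unfolding abs_mult using assms by (intro mult_mono) auto

lemma borel_measurable_exp_compose:
  fixes f :: "'a \<Rightarrow> real"
  shows "f \<in> borel_measurable M \<Longrightarrow> (\<lambda>w. exp (f w)) \<in> borel_measurable M"
  by measurable

text \<open>The quantity inside the absolute value is nonnegative, so an upper bound suffices. From
  exp a (1 - a) \<le> 1 it is at most a (exp a - 1), and the Lipschitz bound for exp gives the
  quadratic order.\<close>

lemma abs_exp_minus_one_minus_le:
  fixes a :: real
  assumes "\<bar>a\<bar> \<le> M"
  shows "\<bar>exp a - 1 - a\<bar> \<le> exp M * M\<^sup>2"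
proof -
  have "exp a * (1 - a) \<le> exp a * exp (- a)"
    using exp_ge_add_one_self[of "- a"] by (intro mult_left_mono) auto
  then have "exp a - 1 - a \<le> a * (exp a - exp 0)" by (simp add: algebra_simps flip: exp_add)
  also have "\<dots> \<le> \<bar>a\<bar> * \<bar>exp a - exp 0\<bar>" by (metis abs_ge_self abs_mult)
  also have "\<dots> \<le> \<bar>a\<bar> * (exp M * \<bar>a - 0\<bar>)"
    using assms by (intro mult_left_mono abs_exp_diff_le) auto
  also have "\<dots> = exp M * \<bar>a\<bar>\<^sup>2" by (simp add: power2_eq_square)
  also have "\<dots> \<le> exp M * M\<^sup>2" using assms by (intro mult_left_mono power_mono) auto
  finally show ?thesis using exp_ge_add_one_self[of a] by linarith
qed

section \<open>Markov property and small increments\<close>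

context circle_diffusion
begin

lemma space_Pr: "space (Pr x) = \<Omega>"
  using subalg[of 0 x] space_F[of 0] by (simp add: subalgebra_def)

lemma borel_measurable_F_Pr:
  "t \<ge> 0 \<Longrightarrow> Z \<in> borel_measurable (\<F> t) \<Longrightarrow> Z \<in> borel_measurable (Pr x)"
  using subalg measurable_from_subalg by blast

lemma borel_measurable_F_mono:
  assumes "s \<le> t" "Z \<in> borel_measurable (\<F> s)"
  shows "Z \<in> borel_measurable (\<F> t)"
  by (rule measurable_from_subalg[OF _ assms(2)])
     (use assms(1) sets_F_mono space_F in \<open>auto simp: subalgebra_def\<close>)

lemma borel_measurable_X:
  fixes f :: "circle \<Rightarrow> real"
  assumes "continuous_on UNIV f" "0 \<le> s" "s \<le> t"
  shows "(\<lambda>w. f (X s w)) \<in> borel_measurable (\<F> t)"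
  by (rule borel_measurable_F_mono[OF assms(3)])
     (rule measurable_compose[OF adapted[OF assms(2)] borel_measurable_continuous_onI[OF assms(1)]])

lemma borel_measurable_X_Pr:
  fixes f :: "circle \<Rightarrow> real"
  assumes "continuous_on UNIV f" "0 \<le> s"
  shows "(\<lambda>w. f (X s w)) \<in> borel_measurable (Pr x)"
  using borel_measurable_F_Pr[OF assms(2) borel_measurable_X[OF assms order_refl]] .

lemma integrable_bounded:
  fixes Z :: "'w \<Rightarrow> real"
  assumes "Z \<in> borel_measurable (Pr x)" "\<And>w. w \<in> \<Omega> \<Longrightarrow> \<bar>Z w\<bar> \<le> B"
  shows "integrable (Pr x) Z"
proof -
  interpret prob_space "Pr x" by (rule prob)
  show ?thesis
    by (rule integrable_const_bound[of _ B]) (use assms in \<open>auto simp: space_Pr\<close>)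
qed

lemma integral_abs_le:
  fixes Z :: "'w \<Rightarrow> real"
  assumes "Z \<in> borel_measurable (Pr x)" "\<And>w. w \<in> \<Omega> \<Longrightarrow> \<bar>Z w\<bar> \<le> B"
  shows "\<bar>\<integral>w. Z w \<partial>Pr x\<bar> \<le> B"
proof -
  interpret prob_space "Pr x" by (rule prob)
  have "\<bar>\<integral>w. Z w \<partial>Pr x\<bar> \<le> (\<integral>w. \<bar>Z w\<bar> \<partial>Pr x)" by (rule integral_abs_bound)
  also have "\<dots> \<le> B"
    using integrable_bounded[OF assms]
    by (intro integral_le_const) (auto simp: space_Pr assms(2))
  finally show ?thesis .
qed

lemma integral_X_0:
  fixes f :: "circle \<Rightarrow> real"
  assumes "continuous_on UNIV f"
  shows "(\<integral>w. f (X 0 w) \<partial>Pr x) = f x"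
proof -
  interpret prob_space "Pr x" by (rule prob)
  have "(\<integral>w. f (X 0 w) \<partial>Pr x) = (\<integral>w. f x \<partial>Pr x)"
    by (rule integral_cong_AE) (use start[of x] assms borel_measurable_X_Pr in auto)
  then show ?thesis by (simp add: prob_space)
qed

text \<open>The Markov property tested against a bounded variable known at time \<open>s\<close>:
  the defining identity of conditional expectation replaces \<open>f (X (s + t) w)\<close> by its
  conditional expectation under the integral.\<close>

lemma integral_mult_X:
  fixes f :: "circle \<Rightarrow> real"
  assumes "0 \<le> s" "0 \<le> t" "continuous_on UNIV f"
    and Z: "Z \<in> borel_measurable (\<F> s)" "\<And>w. w \<in> \<Omega> \<Longrightarrow> \<bar>Z w\<bar> \<le> B"
  shows "(\<integral>w. Z w * f (X (s + t) w) \<partial>Pr x) = (\<integral>w. Z w * transition X Pr t f (X s w) \<partial>Pr x)"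
proof -
  interpret P: prob_space "Pr x" by (rule prob)
  interpret S: finite_measure_subalgebra "Pr x" "\<F> s"
    by unfold_locales (rule subalg[OF assms(1)])
  obtain C where C: "\<And>x. \<bar>f x\<bar> \<le> C"
    using circle_continuous_bounded[OF assms(3)] by metis
  have m: "(\<lambda>w. f (X (s + t) w)) \<in> borel_measurable (Pr x)"
    using assms by (intro borel_measurable_X_Pr) auto
  have Zm: "Z \<in> borel_measurable (Pr x)" using borel_measurable_F_Pr[OF assms(1) Z(1)] .
  have "integrable (Pr x) (\<lambda>w. Z w * f (X (s + t) w))"
  proof (rule integrable_bounded)
    show "\<bar>Z w * f (X (s + t) w)\<bar> \<le> B * C" if "w \<in> \<Omega>" for w
      unfolding abs_mult using Z(2)[OF that] C by (intro mult_mono) (auto intro: order_trans[OF abs_ge_zero])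
  qed (intro borel_measurable_times Zm m)
  then have "(\<integral>w. Z w * f (X (s + t) w) \<partial>Pr x)
      = (\<integral>w. Z w * real_cond_exp (Pr x) (\<F> s) (\<lambda>w. f (X (s + t) w)) w \<partial>Pr x)"
    by (rule S.real_cond_exp_intg(2)[symmetric, OF _ Z(1) m])
  also have "\<dots> = (\<integral>w. Z w * transition X Pr t f (X s w) \<partial>Pr x)"
  proof (rule integral_cong_AE)
    show "AE w in Pr x. Z w * real_cond_exp (Pr x) (\<F> s) (\<lambda>w. f (X (s + t) w)) w
        = Z w * transition X Pr t f (X s w)"
      using markov[OF assms(1,2,3)] by eventually_elim simp
    show "(\<lambda>w. Z w * transition X Pr t f (X s w)) \<in> borel_measurable (Pr x)"
      by (intro borel_measurable_times Zm borel_measurable_X_Pr feller assms)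
  qed (intro borel_measurable_times Zm borel_measurable_cond_exp2)
  finally show ?thesis .
qed

end

section \<open>Small increments of Brownian motion\<close>

context circle_brownian_motion
begin

text \<open>The difference quotients converge uniformly to the bounded function
  \<open>genL f\<close>. For small \<open>h\<close> they are therefore at most \<open>1 + B\<close>,
  and the increment is at most \<open>(1 + B) * h\<close>, uniformly in the starting point.\<close>

lemma transition_C2_le:
  assumes "f \<in> C2_circle" "e > 0"
  obtains d where "d > 0" "\<And>h x. 0 < h \<Longrightarrow> h < d \<Longrightarrow> \<bar>transition X Pr h f x - f x\<bar> \<le> e"
proof -
  obtain B where B: "B > 0" "\<And>x. \<bar>genL f x\<bar> \<le> B"
    using circle_continuous_bounded[OF genL_continuous[OF assms(1)]] by metis
  have "uniform_limit UNIV (\<lambda>t x. (transition X Pr t f x - f x) / t) (genL f) (at_right 0)"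
    using generator assms(1) unfolding has_generator_def by blast
  from uniform_limitD[OF this zero_less_one]
  obtain d where d: "d > 0"
    "\<And>h x. 0 < h \<Longrightarrow> h < d \<Longrightarrow> \<bar>(transition X Pr h f x - f x) / h - genL f x\<bar> < 1"
    unfolding eventually_at_right_field dist_real_def by auto
  show ?thesis
  proof (rule that[of "min d (e / (1 + B))"])
    show "min d (e / (1 + B)) > 0" using d(1) B assms(2) by auto
    fix h x assume h: "0 < h" "h < min d (e / (1 + B))"
    have "\<bar>(transition X Pr h f x - f x) / h\<bar> \<le> 1 + B"
      using d(2)[of h x] h B(2)[of x] by linarith
    then have "\<bar>transition X Pr h f x - f x\<bar> \<le> (1 + B) * h" using h by (simp add: field_simps)
    also have "\<dots> \<le> e" using h B by (simp add: field_simps)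
    finally show "\<bar>transition X Pr h f x - f x\<bar> \<le> e" .
  qed
qed

lemma borel_measurable_gap:
  assumes "0 \<le> s" "0 \<le> t"
  shows "(\<lambda>w. circle_gap (X s w) (X t w)) \<in> borel_measurable (Pr x)"
  unfolding circle_gap_def
  by (intro borel_measurable_diff borel_measurable_add borel_measurable_times borel_measurable_const
      borel_measurable_X_Pr C2_circle_continuous circle_cos_C2 circle_sin_C2 assms)

text \<open>Conditioning at time \<open>s\<close> replaces the cosine and sine at time
  \<open>s + h\<close> by their transitions evaluated at \<open>X s w\<close>. Writing the constant
  1 as cos^2 + sin^2 at the same point then exhibits differences that are small by the
  generator.\<close>

lemma integral_gap_eq:
  assumes "0 \<le> s" "0 \<le> h"
  shows "(\<integral>w. circle_gap (X s w) (X (s + h) w) \<partial>Pr x)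
    = (\<integral>w. circle_cos (X s w) * (circle_cos (X s w) - transition X Pr h circle_cos (X s w))
        + circle_sin (X s w) * (circle_sin (X s w) - transition X Pr h circle_sin (X s w)) \<partial>Pr x)"
proof -
  interpret P: prob_space "Pr x" by (rule prob)
  note c = C2_circle_continuous[OF circle_cos_C2] and s = C2_circle_continuous[OF circle_sin_C2]
  have sh: "0 \<le> s + h" using assms by simp
  have int: "integrable (Pr x) (\<lambda>w. f (X s w) * g (X t w))"
    if fg: "continuous_on UNIV f" "continuous_on UNIV g" "0 \<le> t" for f g :: "circle \<Rightarrow> real" and t
  proof -
    obtain B where B: "B > 0" "\<And>x. \<bar>f x\<bar> \<le> B" using circle_continuous_bounded[OF fg(1)] by metis
    obtain C where C: "C > 0" "\<And>x. \<bar>g x\<bar> \<le> C" using circle_continuous_bounded[OF fg(2)] by metis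
    show ?thesis
      using B C
      by (intro integrable_bounded[of _ _ "B * C"] borel_measurable_times borel_measurable_X_Pr fg assms)
         (auto simp: abs_mult less_imp_le intro!: mult_mono)
  qed
  have m: "(\<integral>w. f (X s w) * f (X (s + h) w) \<partial>Pr x) = (\<integral>w. f (X s w) * transition X Pr h f (X s w) \<partial>Pr x)"
    if f: "continuous_on UNIV f" for f :: "circle \<Rightarrow> real"
  proof -
    obtain B where B: "\<And>x. \<bar>f x\<bar> \<le> B" using circle_continuous_bounded[OF f] by metis
    show ?thesis
      by (rule integral_mult_X[OF assms f borel_measurable_X[OF f assms(1) order_refl] B])
  qed
  note ints = int[OF c c sh] int[OF s s sh] int[OF c c assms(1)] int[OF s s assms(1)]
    int[OF c feller[OF assms(2) c] assms(1)] int[OF s feller[OF assms(2) s] assms(1)]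
  have "(\<integral>w. circle_gap (X s w) (X (s + h) w) \<partial>Pr x)
      = 1 - ((\<integral>w. circle_cos (X s w) * circle_cos (X (s + h) w) \<partial>Pr x)
          + (\<integral>w. circle_sin (X s w) * circle_sin (X (s + h) w) \<partial>Pr x))"
    unfolding circle_gap_def using ints by (simp add: P.prob_space)
  also have "\<dots> = (\<integral>w. 1 - (circle_cos (X s w) * transition X Pr h circle_cos (X s w)
      + circle_sin (X s w) * transition X Pr h circle_sin (X s w)) \<partial>Pr x)"
    unfolding m[OF c] m[OF s] using ints by (simp add: P.prob_space)
  also have "\<dots> = (\<integral>w. circle_cos (X s w) * (circle_cos (X s w) - transition X Pr h circle_cos (X s w))
        + circle_sin (X s w) * (circle_sin (X s w) - transition X Pr h circle_sin (X s w)) \<partial>Pr x)"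
    using circle_gap_self by (intro Bochner_Integration.integral_cong refl) (simp add: circle_gap_def algebra_simps)
  finally show ?thesis .
qed

text \<open>After conditioning, the integrand depends on \<open>X s w\<close> alone and is bounded
  by \<open>e\<close> at every position \<open>y\<close>; this is why \<open>d\<close> depends
  neither on \<open>s\<close> nor on \<open>x\<close>.\<close>

lemma integral_gap_le:
  assumes "e > 0"
  obtains d where "d > 0"
    "\<And>s h x. 0 \<le> s \<Longrightarrow> 0 \<le> h \<Longrightarrow> h < d \<Longrightarrow> (\<integral>w. circle_gap (X s w) (X (s + h) w) \<partial>Pr x) \<le> e"
proof -
  have e2: "e / 2 > 0" using assms by simp
  obtain d1 where d1: "d1 > 0"
    "\<And>h x. 0 < h \<Longrightarrow> h < d1 \<Longrightarrow> \<bar>transition X Pr h circle_cos x - circle_cos x\<bar> \<le> e / 2"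
    using transition_C2_le[OF circle_cos_C2 e2] by metis
  obtain d2 where d2: "d2 > 0"
    "\<And>h x. 0 < h \<Longrightarrow> h < d2 \<Longrightarrow> \<bar>transition X Pr h circle_sin x - circle_sin x\<bar> \<le> e / 2"
    using transition_C2_le[OF circle_sin_C2 e2] by metis
  show ?thesis
  proof (rule that[of "min d1 d2"])
    show "min d1 d2 > 0" using d1 d2 by simp
    fix s h :: real and x assume *: "0 \<le> s" "0 \<le> h" "h < min d1 d2"
    show "(\<integral>w. circle_gap (X s w) (X (s + h) w) \<partial>Pr x) \<le> e"
    \<comment> \<open>The generator limit concerns positive times only; at \<open>h = 0\<close> the
      gap itself vanishes.\<close>
    proof (cases "h = 0")
      case True
      then show ?thesis using assms by (simp add: circle_gap_self)
    next
      case False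
      have h: "0 < h" "h < d1" "h < d2" using False * by auto
      have b: "\<bar>circle_cos y * (circle_cos y - transition X Pr h circle_cos y)
        + circle_sin y * (circle_sin y - transition X Pr h circle_sin y)\<bar> \<le> e" for y
      proof -
        have "\<bar>circle_cos y * (circle_cos y - transition X Pr h circle_cos y)\<bar> \<le> 1 * (e / 2)"
          unfolding abs_mult
          using d1(2)[OF h(1,2), of y] abs_circle_cos_le by (intro mult_mono) (auto simp: abs_minus_commute)
        moreover have "\<bar>circle_sin y * (circle_sin y - transition X Pr h circle_sin y)\<bar> \<le> 1 * (e / 2)"
          unfolding abs_mult
          using d2(2)[OF h(1,3), of y] abs_circle_sin_le by (intro mult_mono) (auto simp: abs_minus_commute)
        ultimately show ?thesis by linarith
      qed
      have "\<bar>\<integral>w. circle_gap (X s w) (X (s + h) w) \<partial>Pr x\<bar> \<le> e"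
        unfolding integral_gap_eq[OF *(1,2)]
        by (intro integral_abs_le b borel_measurable_diff borel_measurable_add borel_measurable_times
            borel_measurable_X_Pr C2_circle_continuous circle_cos_C2 circle_sin_C2 feller *)
      then show ?thesis by linarith
    qed
  qed
qed

lemma integral_increment_le:
  fixes f :: "circle \<Rightarrow> real"
  assumes f: "continuous_on UNIV f" and "e > 0"
  obtains d where "d > 0"
    "\<And>s h x. 0 \<le> s \<Longrightarrow> 0 \<le> h \<Longrightarrow> h < d \<Longrightarrow> (\<integral>w. \<bar>f (X (s + h) w) - f (X s w)\<bar> \<partial>Pr x) \<le> e"
proof -
  obtain C where C: "C \<ge> 0" "\<And>x y. \<bar>f y - f x\<bar> \<le> e / 2 + C * circle_gap x y"
    using continuous_le_circle_gap[OF f, of "e / 2"] assms(2) by auto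
  obtain B where B: "\<And>x. \<bar>f x\<bar> \<le> B" using circle_continuous_bounded[OF f] by metis
  \<comment> \<open>Multiplied by \<open>C\<close> this is at most \<open>e / 2\<close>; the summand
    1 admits \<open>C = 0\<close>.\<close>
  have "e / (2 * (C + 1)) > 0" using C(1) assms(2) by simp
  then obtain d where d: "d > 0" "\<And>s h x. 0 \<le> s \<Longrightarrow> 0 \<le> h \<Longrightarrow> h < d \<Longrightarrow>
      (\<integral>w. circle_gap (X s w) (X (s + h) w) \<partial>Pr x) \<le> e / (2 * (C + 1))"
    using integral_gap_le by metis
  show ?thesis
  proof (rule that[OF d(1)])
    fix s h :: real and x assume *: "0 \<le> s" "0 \<le> h" "h < d"
    interpret P: prob_space "Pr x" by (rule prob)
    have ig: "integrable (Pr x) (\<lambda>w. circle_gap (X s w) (X (s + h) w))"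
      using * by (intro integrable_bounded[of _ _ 2] borel_measurable_gap)
        (auto simp: circle_gap_nonneg circle_gap_le)
    have "(\<integral>w. \<bar>f (X (s + h) w) - f (X s w)\<bar> \<partial>Pr x)
        \<le> (\<integral>w. e / 2 + C * circle_gap (X s w) (X (s + h) w) \<partial>Pr x)"
    proof (rule integral_mono)
      have "\<bar>f y - f z\<bar> \<le> 2 * B" for y z using B[of y] B[of z] by linarith
      then show "integrable (Pr x) (\<lambda>w. \<bar>f (X (s + h) w) - f (X s w)\<bar>)"
        using * f
        by (intro integrable_bounded[of _ _ "2 * B"] borel_measurable_abs borel_measurable_diff
            borel_measurable_X_Pr) auto
    qed (use ig C in auto)
    also have "\<dots> = e / 2 + C * (\<integral>w. circle_gap (X s w) (X (s + h) w) \<partial>Pr x)"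
      using ig by (simp add: P.prob_space)
    also have "\<dots> \<le> e / 2 + C * (e / (2 * (C + 1)))"
      using d(2)[OF *] C(1) by (intro add_left_mono mult_left_mono) auto
    also have "\<dots> \<le> e" using C(1) assms(2) by (simp add: field_simps)
    finally show "(\<integral>w. \<bar>f (X (s + h) w) - f (X s w)\<bar> \<partial>Pr x) \<le> e" .
  qed
qed

text \<open>The generator gives convergence only on C^2 functions; for continuous \<open>f\<close>
  it follows from the increment estimate with \<open>s = 0\<close>, since \<open>X 0 w = x\<close>
  almost surely.\<close>

lemma transition_uniform_limit:
  fixes f :: "circle \<Rightarrow> real"
  assumes f: "continuous_on UNIV f"
  shows "uniform_limit UNIV (\<lambda>t. transition X Pr t f) f (at_right 0)"
proof (rule uniform_limitI)
  fix e :: real assume "e > 0"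
  then have "e / 2 > 0" by simp
  then obtain d where d: "d > 0" "\<And>s h x. 0 \<le> s \<Longrightarrow> 0 \<le> h \<Longrightarrow> h < d \<Longrightarrow>
      (\<integral>w. \<bar>f (X (s + h) w) - f (X s w)\<bar> \<partial>Pr x) \<le> e / 2"
    using integral_increment_le[OF f] by metis
  obtain B where B: "\<And>x. \<bar>f x\<bar> \<le> B" using circle_continuous_bounded[OF f] by metis
  have "dist (transition X Pr h f x) (f x) < e" if "0 < h" "h < d" for h x
  proof -
    have int: "integrable (Pr x) (\<lambda>w. f (X h w))" "integrable (Pr x) (\<lambda>w. f (X 0 w))"
      using that by (auto intro!: integrable_bounded[of _ _ B] borel_measurable_X_Pr f B)
    have "transition X Pr h f x - f x = (\<integral>w. f (X h w) - f (X 0 w) \<partial>Pr x)"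
      using int integral_X_0[OF f, of x] by (simp add: transition_def)
    also have "\<bar>\<dots>\<bar> \<le> (\<integral>w. \<bar>f (X h w) - f (X 0 w)\<bar> \<partial>Pr x)" by (rule integral_abs_bound)
    also have "\<dots> \<le> e / 2" using d(2)[of 0 h x] that by simp
    finally show ?thesis using \<open>e > 0\<close> by (simp add: dist_real_def)
  qed
  then show "\<forall>\<^sub>F t in at_right 0. \<forall>x\<in>UNIV. dist (transition X Pr t f x) (f x) < e"
    unfolding eventually_at_right_field using d(1) by auto
qed

end

section \<open>The Feynman--Kac semigroup\<close>

locale feynman_kac = circle_brownian_motion +
  fixes V :: "circle \<Rightarrow> real"
  assumes V_continuous: "continuous_on UNIV V"
begin

definition V_integral :: "real \<Rightarrow> real \<Rightarrow> 'a \<Rightarrow> real" where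
  "V_integral a b w = integral {a..b} (\<lambda>r. V (X r w))"

definition FK :: "real \<Rightarrow> (circle \<Rightarrow> real) \<Rightarrow> circle \<Rightarrow> real" where
  "FK t f x = (\<integral>w. exp (V_integral 0 t w) * f (X t w) \<partial>Pr x)"

text \<open>A Riemann sum of \<open>V\<close> along the path on [a, a + n h]. With right endpoints
  the last sample is taken at the terminal time, so its exponential can be merged with the terminal
  function into one transition.\<close>

definition V_sum :: "real \<Rightarrow> real \<Rightarrow> nat \<Rightarrow> 'a \<Rightarrow> real" where
  "V_sum a h n w = h * (\<Sum>k<n. V (X (a + real (Suc k) * h) w))"

text \<open>One factor of the Lie-Trotter product: multiplication by exp(h V), then the Brownian
  transition over time h.\<close>

definition FK_step :: "real \<Rightarrow> (circle \<Rightarrow> real) \<Rightarrow> circle \<Rightarrow> real" where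
  "FK_step h f = transition X Pr h (\<lambda>y. exp (h * V y) * f y)"

text \<open>Fixing one bound for \<open>V\<close> lets all later constants be explicit in
  it.\<close>

definition V_bound :: real where
  "V_bound = (SOME B. B > 0 \<and> (\<forall>x. \<bar>V x\<bar> \<le> B))"

lemma V_bound: "V_bound > 0" "\<bar>V x\<bar> \<le> V_bound"
proof -
  have "\<exists>B. B > 0 \<and> (\<forall>x. \<bar>V x\<bar> \<le> B)"
    using circle_continuous_bounded[OF V_continuous] by metis
  from someI_ex[OF this] show "V_bound > 0" "\<bar>V x\<bar> \<le> V_bound" unfolding V_bound_def by auto
qed

section \<open>Bounds and adaptedness of the exponent\<close>

lemma path_continuous:
  assumes "w \<in> \<Omega>" "0 \<le> a"
  shows "continuous_on {a..} (\<lambda>r. V (X r w))"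
  by (rule continuous_on_compose2[OF V_continuous continuous_on_subset[OF cont_paths[OF assms(1)]]])
     (use assms(2) in auto)

lemma path_integrable:
  assumes "w \<in> \<Omega>" "0 \<le> a"
  shows "(\<lambda>r. V (X r w)) integrable_on {a..b}"
  by (intro integrable_continuous_interval continuous_on_subset[OF path_continuous[OF assms]]) auto

lemma abs_V_integral_le:
  assumes "w \<in> \<Omega>" "0 \<le> a" "0 \<le> t"
  shows "\<bar>V_integral a (a + t) w\<bar> \<le> t * V_bound"
proof -
  have "norm (integral {a..a + t} (\<lambda>r. V (X r w))) \<le> V_bound * (a + t - a)"
    using assms(3) V_bound(2)
    by (intro integral_bound continuous_on_subset[OF path_continuous[OF assms(1,2)]]) auto
  then show ?thesis by (simp add: V_integral_def mult.commute)
qed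

lemma abs_V_sum_le:
  assumes "0 \<le> h"
  shows "\<bar>V_sum a h n w\<bar> \<le> real n * h * V_bound"
proof -
  have "\<bar>\<Sum>k<n. V (X (a + real (Suc k) * h) w)\<bar> \<le> (\<Sum>k<n. V_bound)"
    by (rule order_trans[OF sum_abs sum_mono]) (rule V_bound)
  then have "h * \<bar>\<Sum>k<n. V (X (a + real (Suc k) * h) w)\<bar> \<le> h * (\<Sum>k<n. V_bound)"
    using assms by (rule mult_left_mono)
  then show ?thesis using assms by (simp add: V_sum_def abs_mult ac_simps)
qed

lemma V_sum_measurable:
  assumes "0 \<le> a" "0 \<le> h" "a + real n * h \<le> b"
  shows "V_sum a h n \<in> borel_measurable (\<F> b)"
proof -
  have "a + real (Suc k) * h \<le> b" if "k < n" for k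
  proof -
    have "real (Suc k) * h \<le> real n * h" using that assms(2) by (intro mult_right_mono) auto
    then show ?thesis using assms(3) by linarith
  qed
  then show ?thesis
    unfolding V_sum_def[abs_def] using assms
    by (intro borel_measurable_times borel_measurable_const borel_measurable_sum borel_measurable_X
        V_continuous) auto
qed

lemma V_sum_tendsto:
  assumes "w \<in> \<Omega>" "0 \<le> a" "0 \<le> t"
  shows "(\<lambda>n. V_sum a (t / real (Suc n)) (Suc n) w) \<longlonglongrightarrow> V_integral a (a + t) w"
  using riemann_sum_tendsto[OF path_continuous[OF assms(1,2)] assms(3)]
  by (simp only: V_sum_def V_integral_def)

text \<open>On every path the integral is a limit of Riemann sums, each of which uses positions up
  to time \<open>a + t\<close> only.\<close>

lemma V_integral_measurable:
  assumes "0 \<le> a" "0 \<le> t"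
  shows "V_integral a (a + t) \<in> borel_measurable (\<F> (a + t))"
proof (rule borel_measurable_LIMSEQ_real)
  show "(\<lambda>n. V_sum a (t / real (Suc n)) (Suc n) w) \<longlonglongrightarrow> V_integral a (a + t) w" if "w \<in> space (\<F> (a + t))" for w
    using that assms by (intro V_sum_tendsto) (auto simp: space_F)
  show "V_sum a (t / real (Suc n)) (Suc n) \<in> borel_measurable (\<F> (a + t))" for n
    using assms by (intro V_sum_measurable) (auto simp: field_simps)
qed

lemma V_integral_0_measurable:
  assumes "0 \<le> t"
  shows "V_integral 0 t \<in> borel_measurable (\<F> t)"
  using V_integral_measurable[of 0 t] assms by simp

lemma V_integral_combine:
  assumes "w \<in> \<Omega>" "0 \<le> s" "0 \<le> t"
  shows "V_integral 0 (s + t) w = V_integral 0 s w + V_integral s (s + t) w"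
  unfolding V_integral_def using assms
  by (intro Henstock_Kurzweil_Integration.integral_combine[symmetric] path_integrable) auto

section \<open>The Lie-Trotter scheme and its convergence\<close>

lemma FK_step_continuous:
  assumes "0 \<le> h" "continuous_on UNIV f"
  shows "continuous_on UNIV (FK_step h f)"
  unfolding FK_step_def by (intro feller assms continuous_intros V_continuous)

lemma FK_step_power_continuous:
  assumes "0 \<le> h" "continuous_on UNIV f"
  shows "continuous_on UNIV ((FK_step h ^^ n) f)"
  by (induction n) (auto intro: assms FK_step_continuous)

text \<open>The Markov property enters only here: it integrates out one time step after the other,
  starting with the last.\<close>

lemma integral_exp_V_sum:
  assumes "0 \<le> s" "0 \<le> h" "continuous_on UNIV f"
    and Z: "Z \<in> borel_measurable (\<F> s)" "\<And>w. w \<in> \<Omega> \<Longrightarrow> \<bar>Z w\<bar> \<le> B"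
  shows "(\<integral>w. Z w * exp (V_sum s h n w) * f (X (s + real n * h) w) \<partial>Pr x)
    = (\<integral>w. Z w * (FK_step h ^^ n) f (X s w) \<partial>Pr x)"
  using assms(3)
\<comment> \<open>\<open>f\<close> must vary: once the last time step is integrated out, the
  terminal function is \<open>FK_step h f\<close>.\<close>
proof (induction n arbitrary: f)
  case 0
  then show ?case by (simp add: V_sum_def)
next
  case (Suc n)
  \<comment> \<open>\<open>u\<close> is the last sampling time but one. The factors known at
    \<open>u\<close> together act as the test variable, and the remaining sample sits at
    \<open>u + h\<close> with \<open>f\<close>.\<close>
  define u where "u = s + real n * h"
  have u: "s + real (Suc n) * h = u + h" "0 \<le> u" "s \<le> u"
    using assms(1,2) by (auto simp: u_def algebra_simps)
  have "(\<integral>w. Z w * exp (V_sum s h (Suc n) w) * f (X (s + real (Suc n) * h) w) \<partial>Pr x)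
      = (\<integral>w. (Z w * exp (V_sum s h n w)) * (exp (h * V (X (u + h) w)) * f (X (u + h) w)) \<partial>Pr x)"
    unfolding V_sum_def u sum.lessThan_Suc by (simp add: distrib_left exp_add mult.assoc)
  also have "\<dots> = (\<integral>w. (Z w * exp (V_sum s h n w)) * FK_step h f (X u w) \<partial>Pr x)"
    unfolding FK_step_def
  proof (rule integral_mult_X[OF u(2) assms(2)])
    show "continuous_on UNIV (\<lambda>y. exp (h * V y) * f y)"
      by (intro continuous_intros V_continuous Suc.prems)
    have "V_sum s h n \<in> borel_measurable (\<F> u)" by (rule V_sum_measurable) (use assms in \<open>auto simp: u_def\<close>)
    then show "(\<lambda>w. Z w * exp (V_sum s h n w)) \<in> borel_measurable (\<F> u)"
      by (intro borel_measurable_times borel_measurable_F_mono[OF u(3) Z(1)] borel_measurable_exp_compose)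
    show "\<bar>Z w * exp (V_sum s h n w)\<bar> \<le> B * exp (real n * h * V_bound)" if "w \<in> \<Omega>" for w
      unfolding abs_mult using Z(2)[OF that] abs_V_sum_le[OF assms(2), of s n w]
      by (intro mult_mono) (auto intro: order_trans[OF abs_ge_zero])
  qed
  also have "\<dots> = (\<integral>w. Z w * (FK_step h ^^ n) (FK_step h f) (X s w) \<partial>Pr x)"
    unfolding u_def by (rule Suc.IH) (intro FK_step_continuous assms Suc.prems)
  also have "(FK_step h ^^ n) (FK_step h f) = (FK_step h ^^ Suc n) f" by (simp add: funpow_swap1)
  finally show ?case .
qed

lemma FK_step_power_eq:
  assumes "0 \<le> h" "continuous_on UNIV f"
  shows "(FK_step h ^^ n) f x = (\<integral>w. exp (V_sum 0 h n w) * f (X (real n * h) w) \<partial>Pr x)"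
  using integral_exp_V_sum[where s = 0 and h = h and f = f and Z = "\<lambda>_. 1" and B = 1 and n = n and x = x] assms
    integral_X_0[OF FK_step_power_continuous[OF assms], of x n] by simp

lemma exp_V_integral_mult_measurable:
  assumes "0 \<le> t" "continuous_on UNIV f"
  shows "(\<lambda>w. exp (V_integral 0 t w) * f (X t w)) \<in> borel_measurable (Pr x)"
  by (intro borel_measurable_times borel_measurable_exp_compose borel_measurable_X_Pr assms
      borel_measurable_F_Pr[OF _ V_integral_0_measurable])

lemma exp_V_integral_mult_bound:
  assumes "0 \<le> t" "w \<in> \<Omega>" "\<And>x. \<bar>f x\<bar> \<le> c"
  shows "\<bar>exp (V_integral 0 t w) * f (X t w)\<bar> \<le> exp (t * V_bound) * c"
  using abs_V_integral_le[of w 0 t] assms by (intro abs_exp_mult_le) auto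

lemma exp_V_sum_mult_measurable:
  assumes "0 \<le> h" "continuous_on UNIV f"
  shows "(\<lambda>w. exp (V_sum 0 h n w) * f (X (real n * h) w)) \<in> borel_measurable (Pr x)"
  by (intro borel_measurable_times borel_measurable_exp_compose borel_measurable_X_Pr assms
      borel_measurable_F_Pr[OF _ V_sum_measurable[where b = "real n * h"]]) (use assms in auto)

lemma abs_FK_le:
  assumes "0 \<le> t" "continuous_on UNIV f" "\<And>x. \<bar>f x\<bar> \<le> c"
  shows "\<bar>FK t f x\<bar> \<le> exp (t * V_bound) * c"
  unfolding FK_def
  by (intro integral_abs_le exp_V_integral_mult_measurable exp_V_integral_mult_bound assms)

lemma abs_FK_step_power_le:
  assumes "0 \<le> h" "continuous_on UNIV f" "\<And>x. \<bar>f x\<bar> \<le> c"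
  shows "\<bar>(FK_step h ^^ n) f x\<bar> \<le> exp (real n * h * V_bound) * c"
  unfolding FK_step_power_eq[OF assms(1,2)]
  by (intro integral_abs_le exp_V_sum_mult_measurable abs_exp_mult_le abs_V_sum_le assms)

text \<open>A substitute for exchanging expectation and time integral: the bound holds for Riemann
  sums by linearity and passes to the limit by dominated convergence. \<open>G\<close> is the
  reference value of \<open>V\<close> on the block, namely its value at the right end in one
  application and the constant \<open>V x\<close> in another.\<close>

lemma integral_abs_V_integral_diff_le:
  assumes "0 \<le> a" "0 \<le> h" and G: "G \<in> borel_measurable (Pr x)" "\<And>w. w \<in> \<Omega> \<Longrightarrow> \<bar>G w\<bar> \<le> V_bound"
    and le: "\<And>r. a \<le> r \<Longrightarrow> r \<le> a + h \<Longrightarrow> (\<integral>w. \<bar>V (X r w) - G w\<bar> \<partial>Pr x) \<le> e"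
  shows "(\<integral>w. \<bar>V_integral a (a + h) w - h * G w\<bar> \<partial>Pr x) \<le> h * e"
proof -
  have Rm: "V_sum a (h / real (Suc n)) (Suc n) \<in> borel_measurable (Pr x)" for n
    by (rule borel_measurable_F_Pr[OF _ V_sum_measurable[where b = "a + h"]]) (use assms(1,2) in auto)
  have Im: "V_integral a (a + h) \<in> borel_measurable (Pr x)"
    by (rule borel_measurable_F_Pr[OF _ V_integral_measurable]) (use assms(1,2) in auto)
  have lim: "(\<lambda>n. \<integral>w. \<bar>V_sum a (h / real (Suc n)) (Suc n) w - h * G w\<bar> \<partial>Pr x)
      \<longlonglongrightarrow> (\<integral>w. \<bar>V_integral a (a + h) w - h * G w\<bar> \<partial>Pr x)"
  proof (rule integral_dominated_convergence[where w = "\<lambda>_. 2 * h * V_bound"])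
    show "AE w in Pr x. (\<lambda>n. \<bar>V_sum a (h / real (Suc n)) (Suc n) w - h * G w\<bar>) \<longlonglongrightarrow> \<bar>V_integral a (a + h) w - h * G w\<bar>"
      using assms(1,2) by (intro AE_I2 tendsto_intros V_sum_tendsto) (auto simp: space_Pr)
    show "AE w in Pr x. norm \<bar>V_sum a (h / real (Suc n)) (Suc n) w - h * G w\<bar> \<le> 2 * h * V_bound" for n
    proof (rule AE_I2)
      fix w assume "w \<in> space (Pr x)"
      then have "\<bar>h * G w\<bar> \<le> h * V_bound"
        using G(2)[of w] assms(2) by (auto simp: abs_mult space_Pr intro!: mult_left_mono)
      moreover have "\<bar>V_sum a (h / real (Suc n)) (Suc n) w\<bar> \<le> h * V_bound"
        using abs_V_sum_le[of "h / real (Suc n)" a "Suc n" w] assms(2) by simp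
      ultimately show "norm \<bar>V_sum a (h / real (Suc n)) (Suc n) w - h * G w\<bar> \<le> 2 * h * V_bound"
        by simp
    qed
    show "integrable (Pr x) (\<lambda>_. 2 * h * V_bound)" by (rule integrable_bounded) auto
  qed (intro borel_measurable_abs borel_measurable_diff borel_measurable_times borel_measurable_const Rm Im G)+
  have "(\<integral>w. \<bar>V_sum a (h / real (Suc n)) (Suc n) w - h * G w\<bar> \<partial>Pr x) \<le> h * e" for n
  proof -
    define l where "l = h / real (Suc n)"
    have l: "0 \<le> l" "h = real (Suc n) * l" using assms(2) by (auto simp: l_def)
    have r: "0 \<le> a + real (Suc k) * l" "a \<le> a + real (Suc k) * l" "a + real (Suc k) * l \<le> a + h"
      if "k < Suc n" for k
    proof -
      have "real (Suc k) * l \<le> real (Suc n) * l" using that l(1) by (intro mult_right_mono) auto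
      moreover have "0 \<le> real (Suc k) * l" using l(1) by simp
      ultimately show "0 \<le> a + real (Suc k) * l" "a \<le> a + real (Suc k) * l" "a + real (Suc k) * l \<le> a + h"
        using l(2) assms(1) by linarith+
    qed
    have int: "integrable (Pr x) (\<lambda>w. \<bar>V (X (a + real (Suc k) * l) w) - G w\<bar>)" if "k < Suc n" for k
    proof (rule integrable_bounded[of _ _ "2 * V_bound"])
      show "\<bar>\<bar>V (X (a + real (Suc k) * l) w) - G w\<bar>\<bar> \<le> 2 * V_bound" if "w \<in> \<Omega>" for w
        using G(2)[OF that] V_bound(2)[of "X (a + real (Suc k) * l) w"] by simp
    qed (intro borel_measurable_abs borel_measurable_diff borel_measurable_X_Pr V_continuous r that G)
    \<comment> \<open>Since \<open>h = real (Suc n) * l\<close>, the term \<open>h * G w\<close> is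
      spread evenly over the samples, leaving differences at single times.\<close>
    have "(\<integral>w. \<bar>V_sum a l (Suc n) w - h * G w\<bar> \<partial>Pr x)
        \<le> (\<integral>w. l * (\<Sum>k<Suc n. \<bar>V (X (a + real (Suc k) * l) w) - G w\<bar>) \<partial>Pr x)"
    proof (rule integral_mono)
      show "integrable (Pr x) (\<lambda>w. l * (\<Sum>k<Suc n. \<bar>V (X (a + real (Suc k) * l) w) - G w\<bar>))"
        by (intro integrable_mult_right Bochner_Integration.integrable_sum int) simp
      show "\<bar>V_sum a l (Suc n) w - h * G w\<bar> \<le> l * (\<Sum>k<Suc n. \<bar>V (X (a + real (Suc k) * l) w) - G w\<bar>)" for w
      proof -
        have "V_sum a l (Suc n) w - h * G w = l * (\<Sum>k<Suc n. V (X (a + real (Suc k) * l) w) - G w)"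
          unfolding V_sum_def l(2) sum_subtractf by (simp add: algebra_simps)
        then show ?thesis
          using l(1) by (simp add: abs_mult mult_left_mono[OF sum_abs] del: sum.lessThan_Suc)
      qed
      have "\<bar>\<bar>V_sum a l (Suc n) w - h * G w\<bar>\<bar> \<le> 2 * h * V_bound" if "w \<in> \<Omega>" for w
      proof -
        have "\<bar>h * G w\<bar> \<le> h * V_bound"
          using G(2)[OF that] assms(2) by (auto simp: abs_mult intro!: mult_left_mono)
        moreover have "\<bar>V_sum a l (Suc n) w\<bar> \<le> h * V_bound"
          using abs_V_sum_le[OF l(1), of a "Suc n" w] unfolding l(2) .
        ultimately show ?thesis by simp
      qed
      then show "integrable (Pr x) (\<lambda>w. \<bar>V_sum a l (Suc n) w - h * G w\<bar>)"
        by (intro integrable_bounded borel_measurable_abs borel_measurable_diff borel_measurable_times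
            borel_measurable_const Rm[of n, folded l_def] G)
    qed
    also have "\<dots> = l * (\<Sum>k<Suc n. \<integral>w. \<bar>V (X (a + real (Suc k) * l) w) - G w\<bar> \<partial>Pr x)"
      unfolding integral_mult_right_zero
      by (intro arg_cong2[of _ _ _ _ "(*)"] refl Bochner_Integration.integral_sum int) simp
    also have "\<dots> \<le> l * (\<Sum>k<Suc n. e)"
      by (intro mult_left_mono sum_mono le r l(1)) auto
    also have "\<dots> = h * e" by (simp add: l(2) del: sum.lessThan_Suc)
    finally show ?thesis by (simp add: l_def)
  qed
  then show ?thesis by (intro LIMSEQ_le_const2[OF lim]) auto
qed

lemma V_sum_eq_sum: "V_sum a h n w = (\<Sum>k<n. h * V (X (a + real k * h + h) w))"
  unfolding V_sum_def sum_distrib_left by (simp add: algebra_simps)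

lemma V_integral_eq_sum:
  assumes "w \<in> \<Omega>" "0 \<le> h"
  shows "V_integral 0 (real n * h) w = (\<Sum>k<n. V_integral (real k * h) (real k * h + h) w)"
  unfolding V_integral_def using integral_blocks[OF path_continuous[OF assms(1), of 0] assms(2), of n] by simp

text \<open>The two sides differ only in the exponent, a Riemann sum against the integral, and both
  exponents are at most \<open>t * V_bound\<close> in absolute value. The Lipschitz bound for exp
  reduces the difference to block errors, each of mean at most \<open>h * e'\<close>, hence at most
  \<open>t * e'\<close> together, uniformly in \<open>x\<close>.\<close>

lemma FK_step_power_uniform_limit:
  assumes "0 \<le> t" "continuous_on UNIV f"
  shows "uniform_limit UNIV (\<lambda>n. (FK_step (t / real (Suc n)) ^^ Suc n) f) (FK t f) sequentially"
proof (rule uniform_limitI)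
  fix e :: real assume "e > 0"
  obtain c where c: "c > 0" "\<And>x. \<bar>f x\<bar> \<le> c" using circle_continuous_bounded[OF assms(2)] by metis
  define K where "K = exp (t * V_bound) * c"
  have K: "K > 0" using c by (simp add: K_def)
  define e' where "e' = e / (K * t + 1)"
  have "K * t \<ge> 0" using K assms(1) by simp
  then have e': "e' > 0" "K * (t * e') < e" using \<open>e > 0\<close> by (auto simp: e'_def field_simps)
  obtain d where d: "d > 0" "\<And>s h x. 0 \<le> s \<Longrightarrow> 0 \<le> h \<Longrightarrow> h < d \<Longrightarrow>
      (\<integral>w. \<bar>V (X (s + h) w) - V (X s w)\<bar> \<partial>Pr x) \<le> e'"
    using integral_increment_le[OF V_continuous e'(1)] by metis
  obtain N where N: "t / d < real N" using reals_Archimedean2 by blast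
  have "dist ((FK_step (t / real (Suc n)) ^^ Suc n) f x) (FK t f x) < e" if n: "n \<ge> N" for n x
  proof -
    define h where "h = t / real (Suc n)"
    have t: "t = real (Suc n) * h" and h0: "h \<ge> 0" using \<open>t \<ge> 0\<close> by (auto simp: h_def)
    have "t < real N * d" using N d(1) by (simp add: field_simps)
    also have "\<dots> \<le> real (Suc n) * d" using n d(1) by (intro mult_right_mono) auto
    finally have hd: "h < d" by (simp add: h_def field_simps)
    \<comment> \<open>The error on block \<open>k\<close> of replacing the integral by block length
      times the value at the right end.\<close>
    let ?D = "\<lambda>k w. V_integral (real k * h) (real k * h + h) w - h * V (X (real k * h + h) w)"
    have kh: "0 \<le> real k * h" "0 \<le> real k * h + h" for k using h0 by auto
    have Dm: "?D k \<in> borel_measurable (Pr x)" for k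
      by (intro borel_measurable_diff borel_measurable_times borel_measurable_const borel_measurable_X_Pr
          V_continuous borel_measurable_F_Pr[OF _ V_integral_measurable] kh h0)
    have Db: "\<bar>?D k w\<bar> \<le> 2 * h * V_bound" if "w \<in> \<Omega>" for k w
    proof -
      have "\<bar>h * V (X (real k * h + h) w)\<bar> \<le> h * V_bound"
        using h0 V_bound(2) by (auto simp: abs_mult intro!: mult_left_mono)
      then show ?thesis using abs_V_integral_le[OF that kh(1) h0, of k] by linarith
    qed
    have Dint: "integrable (Pr x) (\<lambda>w. \<bar>?D k w\<bar>)" for k
      by (rule integrable_bounded[of _ _ "2 * h * V_bound"]) (use Dm Db in auto)
    have D: "(\<integral>w. \<bar>?D k w\<bar> \<partial>Pr x) \<le> h * e'" for k
    proof (rule integral_abs_V_integral_diff_le[OF kh(1) h0])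
      fix r assume r: "real k * h \<le> r" "r \<le> real k * h + h"
      \<comment> \<open>The increment estimate is applied with \<open>r\<close> as the earlier time
        and the right end of the block as the later one.\<close>
      then show "(\<integral>w. \<bar>V (X r w) - V (X (real k * h + h) w)\<bar> \<partial>Pr x) \<le> e'"
        using d(2)[of r "real k * h + h - r" x] kh(1)[of k] hd by (simp add: abs_minus_commute)
    qed (auto intro!: borel_measurable_X_Pr V_continuous V_bound kh)
    have int: "integrable (Pr x) (\<lambda>w. exp (V_integral 0 t w) * f (X t w))"
      "integrable (Pr x) (\<lambda>w. exp (V_sum 0 h (Suc n) w) * f (X t w))"
      using exp_V_sum_mult_measurable[OF h0 assms(2), of "Suc n" x] abs_V_sum_le[OF h0, of 0 "Suc n"] c
        abs_V_integral_le[OF _ order_refl assms(1)]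
      unfolding t[symmetric]
      by (auto intro!: integrable_bounded[of _ _ K] exp_V_integral_mult_measurable assms abs_exp_mult_le
          exp_V_integral_mult_bound simp: K_def)
    have "\<bar>(FK_step h ^^ Suc n) f x - FK t f x\<bar>
        = \<bar>\<integral>w. exp (V_sum 0 h (Suc n) w) * f (X t w) - exp (V_integral 0 t w) * f (X t w) \<partial>Pr x\<bar>"
      unfolding FK_def FK_step_power_eq[OF h0 assms(2)] t[symmetric]
      by (subst Bochner_Integration.integral_diff[OF int(2,1)]) simp
    also have "\<dots> \<le> (\<integral>w. \<bar>exp (V_sum 0 h (Suc n) w) * f (X t w) - exp (V_integral 0 t w) * f (X t w)\<bar> \<partial>Pr x)"
      by (rule integral_abs_bound)
    also have "\<dots> \<le> (\<integral>w. K * (\<Sum>k<Suc n. \<bar>?D k w\<bar>) \<partial>Pr x)"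
    proof (rule integral_mono)
      show "integrable (Pr x) (\<lambda>w. \<bar>exp (V_sum 0 h (Suc n) w) * f (X t w) - exp (V_integral 0 t w) * f (X t w)\<bar>)"
        by (intro integrable_abs Bochner_Integration.integrable_diff int)
      show "integrable (Pr x) (\<lambda>w. K * (\<Sum>k<Suc n. \<bar>?D k w\<bar>))"
        by (intro integrable_mult_right Bochner_Integration.integrable_sum Dint)
      fix w assume "w \<in> space (Pr x)"
      then have w: "w \<in> \<Omega>" by (simp add: space_Pr)
      have "\<bar>exp (V_sum 0 h (Suc n) w) - exp (V_integral 0 t w)\<bar> \<le> exp (t * V_bound) * \<bar>V_sum 0 h (Suc n) w - V_integral 0 t w\<bar>"
        using abs_V_sum_le[OF h0, of 0 "Suc n" w] abs_V_integral_le[OF w order_refl assms(1)]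
        unfolding t[symmetric] by (intro abs_exp_diff_le) auto
      also have "V_sum 0 h (Suc n) w - V_integral 0 t w = - (\<Sum>k<Suc n. ?D k w)"
        unfolding t V_sum_eq_sum V_integral_eq_sum[OF w h0] sum_subtractf by simp
      also have "exp (t * V_bound) * \<bar>- (\<Sum>k<Suc n. ?D k w)\<bar> \<le> exp (t * V_bound) * (\<Sum>k<Suc n. \<bar>?D k w\<bar>)"
        unfolding abs_minus_cancel by (intro mult_left_mono sum_abs) simp
      finally have "\<bar>exp (V_sum 0 h (Suc n) w) - exp (V_integral 0 t w)\<bar> * \<bar>f (X t w)\<bar>
          \<le> (exp (t * V_bound) * (\<Sum>k<Suc n. \<bar>?D k w\<bar>)) * c"
        using c by (intro mult_mono) (auto intro!: mult_nonneg_nonneg sum_nonneg simp del: sum.lessThan_Suc)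
      then show "\<bar>exp (V_sum 0 h (Suc n) w) * f (X t w) - exp (V_integral 0 t w) * f (X t w)\<bar>
          \<le> K * (\<Sum>k<Suc n. \<bar>?D k w\<bar>)"
        unfolding left_diff_distrib[symmetric] abs_mult K_def by (simp only: ac_simps)
    qed
    also have "\<dots> = K * (\<Sum>k<Suc n. \<integral>w. \<bar>?D k w\<bar> \<partial>Pr x)"
      unfolding integral_mult_right_zero
      by (intro arg_cong2[of _ _ _ _ "(*)"] refl Bochner_Integration.integral_sum Dint)
    also have "\<dots> \<le> K * (\<Sum>k<Suc n. h * e')"
      using K D by (intro mult_left_mono sum_mono) auto
    also have "\<dots> = K * (t * e')" by (simp add: t del: sum.lessThan_Suc)
    also have "\<dots> < e" by (rule e')
    finally show ?thesis by (simp add: dist_real_def h_def)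
  qed
  then show "\<forall>\<^sub>F n in sequentially. \<forall>x\<in>UNIV. dist ((FK_step (t / real (Suc n)) ^^ Suc n) f x) (FK t f x) < e"
    unfolding eventually_sequentially by blast
qed

section \<open>Semigroup properties and generator\<close>

lemma FK_continuous:
  assumes "0 \<le> t" "continuous_on UNIV f"
  shows "continuous_on UNIV (FK t f)"
  by (rule uniform_limit_theorem[OF _ FK_step_power_uniform_limit[OF assms]])
     (use assms in \<open>auto intro!: always_eventually FK_step_power_continuous simp del: funpow.simps\<close>)

lemma FK_0:
  assumes "continuous_on UNIV f"
  shows "FK 0 f = f"
  unfolding FK_def V_integral_def using integral_X_0[OF assms] by auto

text \<open>The exact integral is kept on [0, s] and serves as the test variable, while [s, s + t]
  is discretized. The Markov identity for the discretization equates two sequences; one tends to the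
  left side by convergence of Riemann sums along paths, the other to the right side by convergence
  of the scheme.\<close>

lemma FK_add:
  assumes "0 \<le> s" "0 \<le> t" "continuous_on UNIV f"
  shows "FK (s + t) f = FK s (FK t f)"
proof
  fix x
  obtain c where c: "c > 0" "\<And>x. \<bar>f x\<bar> \<le> c" using circle_continuous_bounded[OF assms(3)] by metis
  have st: "0 \<le> s + t" using assms by simp
  let ?h = "\<lambda>n. t / real (Suc n)"
  have h0: "0 \<le> ?h n" and nh: "real (Suc n) * ?h n = t" for n using assms(2) by auto
  have Zm: "(\<lambda>w. exp (V_integral 0 s w)) \<in> borel_measurable (\<F> s)"
    by (intro borel_measurable_exp_compose V_integral_0_measurable assms)
  have Zb: "\<bar>exp (V_integral 0 s w)\<bar> \<le> exp (s * V_bound)" if "w \<in> \<Omega>" for w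
    using abs_V_integral_le[OF that order_refl assms(1)] by simp
  have ZPm: "(\<lambda>w. exp (V_integral 0 s w)) \<in> borel_measurable (Pr x)"
    by (rule borel_measurable_F_Pr[OF assms(1) Zm])
  have Rm: "V_sum s (?h n) (Suc n) \<in> borel_measurable (Pr x)" for n
    by (rule borel_measurable_F_Pr[OF st V_sum_measurable]) (use assms in auto)
  \<comment> \<open>One dominating constant for both sequences: a factor for [0, s], a factor for
    [s, s + t], and the bound \<open>c\<close> of \<open>f\<close>.\<close>
  define M where "M = exp (s * V_bound) * exp (t * V_bound) * c"
  have lim1: "(\<lambda>n. \<integral>w. exp (V_integral 0 s w) * exp (V_sum s (?h n) (Suc n) w) * f (X (s + t) w) \<partial>Pr x)
      \<longlonglongrightarrow> (\<integral>w. exp (V_integral 0 (s + t) w) * f (X (s + t) w) \<partial>Pr x)"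
  proof (rule integral_dominated_convergence[where w = "\<lambda>_. M"])
    show "AE w in Pr x. (\<lambda>n. exp (V_integral 0 s w) * exp (V_sum s (?h n) (Suc n) w) * f (X (s + t) w))
        \<longlonglongrightarrow> exp (V_integral 0 (s + t) w) * f (X (s + t) w)"
    proof (rule AE_I2)
      fix w assume "w \<in> space (Pr x)"
      then have w: "w \<in> \<Omega>" by (simp add: space_Pr)
      show "(\<lambda>n. exp (V_integral 0 s w) * exp (V_sum s (?h n) (Suc n) w) * f (X (s + t) w))
        \<longlonglongrightarrow> exp (V_integral 0 (s + t) w) * f (X (s + t) w)"
        unfolding V_integral_combine[OF w assms(1,2)] exp_add
        by (intro tendsto_intros V_sum_tendsto w assms)
    qed
    show "AE w in Pr x. norm (exp (V_integral 0 s w) * exp (V_sum s (?h n) (Suc n) w) * f (X (s + t) w)) \<le> M" for n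
    proof (rule AE_I2)
      fix w assume "w \<in> space (Pr x)"
      then have w: "w \<in> \<Omega>" by (simp add: space_Pr)
      show "norm (exp (V_integral 0 s w) * exp (V_sum s (?h n) (Suc n) w) * f (X (s + t) w)) \<le> M"
        using Zb[OF w] abs_V_sum_le[OF h0[of n], of s "Suc n" w] c
        unfolding nh M_def real_norm_def abs_mult by (intro mult_mono) auto
    qed
    show "integrable (Pr x) (\<lambda>_. M)" by (rule integrable_bounded) auto
    show "(\<lambda>w. exp (V_integral 0 (s + t) w) * f (X (s + t) w)) \<in> borel_measurable (Pr x)"
      by (rule exp_V_integral_mult_measurable[OF st assms(3)])
  qed (intro borel_measurable_times borel_measurable_exp_compose ZPm Rm borel_measurable_X_Pr assms st)
  have lim2: "(\<lambda>n. \<integral>w. exp (V_integral 0 s w) * (FK_step (?h n) ^^ Suc n) f (X s w) \<partial>Pr x)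
      \<longlonglongrightarrow> (\<integral>w. exp (V_integral 0 s w) * FK t f (X s w) \<partial>Pr x)"
  proof (rule integral_dominated_convergence[where w = "\<lambda>_. M"])
    show "AE w in Pr x. (\<lambda>n. exp (V_integral 0 s w) * (FK_step (?h n) ^^ Suc n) f (X s w))
        \<longlonglongrightarrow> exp (V_integral 0 s w) * FK t f (X s w)"
      by (intro AE_I2 tendsto_mult tendsto_const
          tendsto_uniform_limitI[OF FK_step_power_uniform_limit[OF assms(2,3)]]) simp
    show "AE w in Pr x. norm (exp (V_integral 0 s w) * (FK_step (?h n) ^^ Suc n) f (X s w)) \<le> M" for n
    proof (rule AE_I2)
      fix w assume "w \<in> space (Pr x)"
      then have w: "w \<in> \<Omega>" by (simp add: space_Pr)
      show "norm (exp (V_integral 0 s w) * (FK_step (?h n) ^^ Suc n) f (X s w)) \<le> M"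
        using Zb[OF w] abs_FK_step_power_le[OF h0[of n] assms(3) c(2), of "Suc n" "X s w"]
        unfolding nh M_def real_norm_def abs_mult mult.assoc by (intro mult_mono) auto
    qed
    show "integrable (Pr x) (\<lambda>_. M)" by (rule integrable_bounded) auto
  qed (intro borel_measurable_times ZPm borel_measurable_X_Pr FK_continuous FK_step_power_continuous assms h0)+
  have "(\<integral>w. exp (V_integral 0 s w) * exp (V_sum s (?h n) (Suc n) w) * f (X (s + t) w) \<partial>Pr x)
      = (\<integral>w. exp (V_integral 0 s w) * (FK_step (?h n) ^^ Suc n) f (X s w) \<partial>Pr x)" for n
    by (rule integral_exp_V_sum[OF assms(1) h0[of n] assms(3) Zm, where n = "Suc n" and x = x, unfolded nh])
       (rule Zb)
  then show "FK (s + t) f x = FK s (FK t f) x"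
    unfolding FK_def[of "s + t"] FK_def[of s] using LIMSEQ_unique[OF lim1] lim2 by simp
qed

lemma FK_linear:
  assumes "0 \<le> t" "continuous_on UNIV f" "continuous_on UNIV g"
  shows "FK t (\<lambda>x. a * f x + b * g x) x = a * FK t f x + b * FK t g x"
proof -
  obtain c where c: "\<And>x. \<bar>f x\<bar> \<le> c" using circle_continuous_bounded[OF assms(2)] by metis
  obtain c' where c': "\<And>x. \<bar>g x\<bar> \<le> c'" using circle_continuous_bounded[OF assms(3)] by metis
  have int: "integrable (Pr x) (\<lambda>w. exp (V_integral 0 t w) * f (X t w))"
      "integrable (Pr x) (\<lambda>w. exp (V_integral 0 t w) * g (X t w))"
    by (rule integrable_bounded exp_V_integral_mult_measurable exp_V_integral_mult_bound assms c c' | assumption)+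
  have "FK t (\<lambda>x. a * f x + b * g x) x
      = (\<integral>w. a * (exp (V_integral 0 t w) * f (X t w)) + b * (exp (V_integral 0 t w) * g (X t w)) \<partial>Pr x)"
    unfolding FK_def by (intro Bochner_Integration.integral_cong refl) (simp add: algebra_simps)
  also have "\<dots> = a * FK t f x + b * FK t g x"
    unfolding FK_def using int by simp
  finally show ?thesis .
qed

text \<open>With I the integral of \<open>V\<close> along the path up to \<open>t\<close>, exp I - 1
  - t V(x) splits into exp I - 1 - I, of order t^2, and I - t V(x), whose mean absolute value is
  o(t) by the increment estimate.\<close>

lemma FK_transition_quotient:
  assumes f: "continuous_on UNIV f"
  shows "uniform_limit UNIV (\<lambda>t x. (FK t f x - transition X Pr t f x) / t - V x * transition X Pr t f x)
    (\<lambda>_. 0) (at_right 0)"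
proof (rule uniform_limitI)
  fix e :: real assume "e > 0"
  obtain c where c: "c > 0" "\<And>x. \<bar>f x\<bar> \<le> c" using circle_continuous_bounded[OF f] by metis
  \<comment> \<open>Two errors of size \<open>t * e'\<close>, each multiplied by \<open>c\<close>,
    add up to \<open>t * (e / 2)\<close>.\<close>
  define e' where "e' = e / (4 * c)"
  have e': "e' > 0" using \<open>e > 0\<close> c by (simp add: e'_def)
  obtain d where d: "d > 0" "\<And>s h x. 0 \<le> s \<Longrightarrow> 0 \<le> h \<Longrightarrow> h < d \<Longrightarrow>
      (\<integral>w. \<bar>V (X (s + h) w) - V (X s w)\<bar> \<partial>Pr x) \<le> e'"
    using integral_increment_le[OF V_continuous e'] by metis
  \<comment> \<open>The bound 1 replaces \<open>exp (t * V_bound)\<close> by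
    \<open>exp V_bound\<close>; the last bound makes the quadratic term at most
    \<open>t * e'\<close>.\<close>
  define d' where "d' = min (min d 1) (e' / (exp V_bound * V_bound\<^sup>2))"
  have d': "d' > 0" using d(1) e' V_bound(1) by (simp add: d'_def)
  have "\<bar>(FK t f x - transition X Pr t f x) / t - V x * transition X Pr t f x\<bar> < e"
    if t: "0 < t" "t < d'" for t x
  proof -
    interpret P: prob_space "Pr x" by (rule prob)
    have t': "0 \<le> t" "t < d" "t \<le> 1" "t * (exp V_bound * V_bound\<^sup>2) \<le> e'"
      using t V_bound(1) by (auto simp: d'_def field_simps)
    let ?E = "\<lambda>w. \<bar>V_integral 0 t w - t * V x\<bar>"
    have Im: "V_integral 0 t \<in> borel_measurable (Pr x)"
      by (rule borel_measurable_F_Pr[OF t'(1) V_integral_0_measurable[OF t'(1)]])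
    have Eint: "integrable (Pr x) ?E"
    proof (rule integrable_bounded[of _ _ "2 * t * V_bound"])
      show "\<bar>?E w\<bar> \<le> 2 * t * V_bound" if "w \<in> \<Omega>" for w
      proof -
        have "\<bar>t * V x\<bar> \<le> t * V_bound" using t'(1) V_bound(2) by (auto simp: abs_mult intro!: mult_left_mono)
        then show ?thesis using abs_V_integral_le[OF that order_refl t'(1)] by simp
      qed
    qed (use Im in measurable)
    have E: "(\<integral>w. ?E w \<partial>Pr x) \<le> t * e'"
    proof -
      have "(\<integral>w. \<bar>V_integral 0 (0 + t) w - t * V x\<bar> \<partial>Pr x) \<le> t * e'"
      proof (rule integral_abs_V_integral_diff_le)
        fix r assume r: "0 \<le> r" "r \<le> 0 + t"
        \<comment> \<open>The starting condition turns \<open>V x\<close> into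
          \<open>V (X 0 w)\<close>, so that the increment estimate applies from time 0.\<close>
        have "(\<integral>w. \<bar>V (X r w) - V x\<bar> \<partial>Pr x) = (\<integral>w. \<bar>V (X (0 + r) w) - V (X 0 w)\<bar> \<partial>Pr x)"
        proof (rule integral_cong_AE)
          show "AE w in Pr x. \<bar>V (X r w) - V x\<bar> = \<bar>V (X (0 + r) w) - V (X 0 w)\<bar>"
            using start[of x] by eventually_elim simp
        qed (use r in \<open>auto intro!: borel_measurable_abs borel_measurable_diff borel_measurable_const
            borel_measurable_X_Pr[OF V_continuous]\<close>)
        then show "(\<integral>w. \<bar>V (X r w) - V x\<bar> \<partial>Pr x) \<le> e'" using d(2)[of 0 r x] r t'(2) by simp
      qed (use t' V_bound in auto)
      then show ?thesis by simp
    qed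
    have fint: "integrable (Pr x) (\<lambda>w. f (X t w))"
      using t'(1) c(2) by (intro integrable_bounded borel_measurable_X_Pr f)
    have FKint: "integrable (Pr x) (\<lambda>w. exp (V_integral 0 t w) * f (X t w))"
      by (rule integrable_bounded exp_V_integral_mult_measurable exp_V_integral_mult_bound f t' c | assumption)+
    have "FK t f x - transition X Pr t f x - t * V x * transition X Pr t f x
        = (\<integral>w. (exp (V_integral 0 t w) - 1 - t * V x) * f (X t w) \<partial>Pr x)"
      unfolding FK_def transition_def left_diff_distrib using fint FKint by simp
    also have "\<bar>\<dots>\<bar> \<le> (\<integral>w. \<bar>(exp (V_integral 0 t w) - 1 - t * V x) * f (X t w)\<bar> \<partial>Pr x)"
      by (rule integral_abs_bound)
    also have "\<dots> \<le> (\<integral>w. (exp (t * V_bound) * (t * V_bound)\<^sup>2 + ?E w) * c \<partial>Pr x)"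
    proof (rule integral_mono)
      show "integrable (Pr x) (\<lambda>w. \<bar>(exp (V_integral 0 t w) - 1 - t * V x) * f (X t w)\<bar>)"
        unfolding left_diff_distrib using fint FKint by simp
      show "integrable (Pr x) (\<lambda>w. (exp (t * V_bound) * (t * V_bound)\<^sup>2 + ?E w) * c)"
        using Eint by simp
      fix w assume "w \<in> space (Pr x)"
      then have w: "w \<in> \<Omega>" by (simp add: space_Pr)
      have "\<bar>exp (V_integral 0 t w) - 1 - V_integral 0 t w\<bar> \<le> exp (t * V_bound) * (t * V_bound)\<^sup>2"
        using abs_V_integral_le[OF w order_refl t'(1)] by (intro abs_exp_minus_one_minus_le) simp
      then have "\<bar>exp (V_integral 0 t w) - 1 - t * V x\<bar> \<le> exp (t * V_bound) * (t * V_bound)\<^sup>2 + ?E w" by linarith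
      then show "\<bar>(exp (V_integral 0 t w) - 1 - t * V x) * f (X t w)\<bar> \<le> (exp (t * V_bound) * (t * V_bound)\<^sup>2 + ?E w) * c"
        unfolding abs_mult using c(2) by (intro mult_mono) auto
    qed
    also have "\<dots> = (exp (t * V_bound) * (t * V_bound)\<^sup>2 + (\<integral>w. ?E w \<partial>Pr x)) * c"
      using Eint by (simp add: P.prob_space)
    also have "\<dots> \<le> (t * e' + t * e') * c"
    proof (intro mult_right_mono add_mono E)
      have "exp (t * V_bound) * (t * V_bound)\<^sup>2 \<le> exp V_bound * (t * V_bound)\<^sup>2"
        using t'(3) V_bound(1) by (intro mult_right_mono) auto
      also have "\<dots> = t * (t * (exp V_bound * V_bound\<^sup>2))" by (simp add: power2_eq_square)
      also have "\<dots> \<le> t * e'" using t' by (intro mult_left_mono) auto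
      finally show "exp (t * V_bound) * (t * V_bound)\<^sup>2 \<le> t * e'" .
    qed (use c in simp)
    also have "\<dots> = t * (e / 2)" using c(1) by (simp add: e'_def field_simps)
    finally have "\<bar>FK t f x - transition X Pr t f x - t * V x * transition X Pr t f x\<bar> \<le> t * (e / 2)" .
    moreover have "FK t f x - transition X Pr t f x - t * V x * transition X Pr t f x
        = t * ((FK t f x - transition X Pr t f x) / t - V x * transition X Pr t f x)"
      using t by (simp add: field_simps)
    ultimately have "t * \<bar>(FK t f x - transition X Pr t f x) / t - V x * transition X Pr t f x\<bar> \<le> t * (e / 2)"
      using t by (simp add: abs_mult)
    then show ?thesis using t \<open>e > 0\<close> by simp
  qed
  then show "\<forall>\<^sub>F t in at_right 0. \<forall>x\<in>UNIV.
      dist ((FK t f x - transition X Pr t f x) / t - V x * transition X Pr t f x) 0 < e"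
    unfolding eventually_at_right_field using d' by auto
qed

lemma V_bounded: "bounded (range V)"
  by (rule circle_continuous_bounded_range[OF V_continuous])

text \<open>\<open>FK t f\<close> is the transition plus \<open>t\<close> times a quotient that
  converges uniformly to the bounded function V f; the factor \<open>t\<close> makes this correction
  vanish.\<close>

lemma FK_uniform_limit:
  assumes f: "continuous_on UNIV f"
  shows "uniform_limit UNIV (\<lambda>t. FK t f) f (at_right 0)"
proof -
  have t0: "uniform_limit UNIV (\<lambda>t _. t) (\<lambda>_. 0 :: real) (at_right 0)"
    by (rule uniform_limitI) (auto simp: eventually_at_right_field dist_real_def)
  note fb = circle_continuous_bounded_range[OF f]
  note Q = transition_uniform_limit[OF f]
  have Vf: "bounded (range (\<lambda>x. V x * f x))"
    by (intro circle_continuous_bounded_range continuous_intros V_continuous f)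
  have "uniform_limit UNIV (\<lambda>t x. V x * transition X Pr t f x) (\<lambda>x. V x * f x) (at_right 0)"
    by (rule uniform_lim_mult[OF uniform_limit_const Q V_bounded fb])
  from uniform_limit_add[OF FK_transition_quotient[OF f] this]
  have "uniform_limit UNIV (\<lambda>t x. (FK t f x - transition X Pr t f x) / t) (\<lambda>x. V x * f x) (at_right 0)"
    by simp
  from uniform_limit_add[OF Q uniform_lim_mult[OF t0 this _ Vf]]
  have "uniform_limit UNIV (\<lambda>t x. transition X Pr t f x + t * ((FK t f x - transition X Pr t f x) / t)) f (at_right 0)"
    by simp
  then show ?thesis
    by (rule uniform_limit_cong[THEN iffD1, rotated 2])
       (auto simp: eventually_at_right_field intro!: exI[of _ 1])
qed

text \<open>The quotient splits into the Brownian one, which tends to L f, and the contribution of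
  the exponential weight, which tends to V f.\<close>

lemma FK_generator:
  assumes "f \<in> C2_circle"
  shows "uniform_limit UNIV (\<lambda>t x. (FK t f x - f x) / t) (schroedinger V f) (at_right 0)"
proof -
  note f = C2_circle_continuous[OF assms]
  note fb = circle_continuous_bounded_range[OF f]
  have 1: "uniform_limit UNIV (\<lambda>t x. V x * transition X Pr t f x) (\<lambda>x. V x * f x) (at_right 0)"
    by (rule uniform_lim_mult[OF uniform_limit_const transition_uniform_limit[OF f] V_bounded fb])
  have 2: "uniform_limit UNIV (\<lambda>t x. (transition X Pr t f x - f x) / t) (genL f) (at_right 0)"
    using generator assms unfolding has_generator_def by blast
  from uniform_limit_add[OF 2 uniform_limit_add[OF FK_transition_quotient[OF f] 1]]
  show ?thesis
    by (simp add: schroedinger_def[abs_def] add_divide_distrib[symmetric])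
qed

end

section \<open>Conjugation by a positive function (Doob transform)\<close>

context feynman_kac
begin

lemma PV_eq: "PV X Pr V lam F t f x = exp (- (lam * t)) / F x * FK t (\<lambda>y. F y * f y) x"
proof -
  have "PV X Pr V lam F t f x
      = (\<integral>w. exp (- (lam * t)) / F x * (exp (V_integral 0 t w) * (F (X t w) * f (X t w))) \<partial>Pr x)"
    unfolding PV_def V_integral_def
    by (intro Bochner_Integration.integral_cong refl) (simp add: exp_minus field_simps)
  also have "\<dots> = exp (- (lam * t)) / F x * FK t (\<lambda>y. F y * f y) x"
    unfolding FK_def by (rule integral_mult_right_zero)
  finally show ?thesis .
qed

context
  fixes F :: "circle \<Rightarrow> real" and lam :: real
  assumes F_C2: "F \<in> C2_circle" and F_pos: "\<And>x. F x > 0"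
begin

lemma F_nz: "F x \<noteq> 0"
  using F_pos[of x] by simp

lemma F_continuous: "continuous_on UNIV F"
  by (rule C2_circle_continuous[OF F_C2])

lemma inverse_F_continuous: "continuous_on UNIV (\<lambda>x. 1 / F x)"
  using F_nz by (intro continuous_intros F_continuous) auto

lemma Ff_continuous: "continuous_on UNIV f \<Longrightarrow> continuous_on UNIV (\<lambda>y. F y * f y)"
  by (intro continuous_intros F_continuous)

lemma PV_continuous:
  assumes "0 \<le> t" "continuous_on UNIV f"
  shows "continuous_on UNIV (PV X Pr V lam F t f)"
  unfolding PV_eq[abs_def] using F_nz
  by (intro continuous_intros F_continuous FK_continuous assms Ff_continuous) auto

lemma PV_linear:
  assumes "0 \<le> t" "continuous_on UNIV f" "continuous_on UNIV g"
  shows "PV X Pr V lam F t (\<lambda>x. a * f x + b * g x)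
    = (\<lambda>x. a * PV X Pr V lam F t f x + b * PV X Pr V lam F t g x)"
proof
  fix x
  have "(\<lambda>y. F y * (a * f y + b * g y)) = (\<lambda>y. a * (F y * f y) + b * (F y * g y))"
    by (simp add: algebra_simps)
  then show "PV X Pr V lam F t (\<lambda>x. a * f x + b * g x) x
    = a * PV X Pr V lam F t f x + b * PV X Pr V lam F t g x"
    unfolding PV_eq using FK_linear[OF assms(1) Ff_continuous[OF assms(2)] Ff_continuous[OF assms(3)]]
    by (simp add: algebra_simps)
qed

lemma PV_bounded:
  assumes "0 \<le> t"
  shows "\<exists>K. \<forall>f c. continuous_on UNIV f \<longrightarrow> (\<forall>x. \<bar>f x\<bar> \<le> c) \<longrightarrow> (\<forall>x. \<bar>PV X Pr V lam F t f x\<bar> \<le> K * c)"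
proof -
  obtain a where a: "a > 0" "\<And>x. \<bar>F x\<bar> \<le> a" using circle_continuous_bounded[OF F_continuous] by metis
  obtain b where b: "b > 0" "\<And>x. \<bar>1 / F x\<bar> \<le> b" using circle_continuous_bounded[OF inverse_F_continuous] by metis
  have "\<bar>PV X Pr V lam F t f x\<bar> \<le> exp (- (lam * t)) * b * exp (t * V_bound) * a * c"
    if f: "continuous_on UNIV f" "\<And>x. \<bar>f x\<bar> \<le> c" for f c x
  proof -
    have "\<bar>F y * f y\<bar> \<le> a * c" for y
      unfolding abs_mult using a f(2) by (intro mult_mono) (auto intro: less_imp_le)
    then have FK: "\<bar>FK t (\<lambda>y. F y * f y) x\<bar> \<le> exp (t * V_bound) * (a * c)"
      by (intro abs_FK_le assms Ff_continuous f)
    have "\<bar>PV X Pr V lam F t f x\<bar> = exp (- (lam * t)) * (\<bar>1 / F x\<bar> * \<bar>FK t (\<lambda>y. F y * f y) x\<bar>)"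
      unfolding PV_eq by (simp add: abs_mult)
    also have "\<dots> \<le> exp (- (lam * t)) * (b * (exp (t * V_bound) * (a * c)))"
      using b FK by (intro mult_left_mono mult_mono) auto
    finally show ?thesis by (simp add: ac_simps)
  qed
  then show ?thesis by blast
qed

lemma PV_0:
  assumes "continuous_on UNIV f"
  shows "PV X Pr V lam F 0 f = f"
  unfolding PV_eq[abs_def] FK_0[OF Ff_continuous[OF assms]] using F_nz by simp

lemma PV_add:
  assumes "0 \<le> s" "0 \<le> t" "continuous_on UNIV f"
  shows "PV X Pr V lam F (s + t) f = PV X Pr V lam F s (PV X Pr V lam F t f)"
proof
  fix x
  have FKc: "continuous_on UNIV (FK t (\<lambda>y. F y * f y))"
    by (intro FK_continuous assms Ff_continuous)
  \<comment> \<open>Here the factor F of the outer operator cancels the 1/F of the inner one. The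
    summand with coefficient 0 brings the function into the two-term form of
    \<open>FK_linear\<close>.\<close>
  have "(\<lambda>y. F y * PV X Pr V lam F t f y)
      = (\<lambda>y. exp (- (lam * t)) * FK t (\<lambda>y. F y * f y) y + 0 * FK t (\<lambda>y. F y * f y) y)"
    unfolding PV_eq using F_nz by simp
  then have "FK s (\<lambda>y. F y * PV X Pr V lam F t f y) x
      = exp (- (lam * t)) * FK (s + t) (\<lambda>y. F y * f y) x"
    using FK_linear[OF assms(1) FKc FKc, of "exp (- (lam * t))" 0 x]
    by (simp add: FK_add[OF assms(1,2) Ff_continuous[OF assms(3)]])
  moreover have "exp (- (lam * (s + t))) = exp (- (lam * s)) * exp (- (lam * t))"
    by (simp add: algebra_simps flip: exp_add)
  ultimately show "PV X Pr V lam F (s + t) f x = PV X Pr V lam F s (PV X Pr V lam F t f) x"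
    unfolding PV_eq[of _ _ "s + t"] PV_eq[of _ _ s] by simp
qed

lemma exp_uniform_limit:
  "uniform_limit (UNIV :: circle set) (\<lambda>t _. exp (- (lam * t))) (\<lambda>_. 1) (at_right 0)"
proof (rule uniform_limitI)
  have "((\<lambda>t. exp (- (lam * t))) \<longlongrightarrow> exp (- (lam * 0))) (at_right 0)"
    by (intro tendsto_intros)
  then show "\<forall>\<^sub>F t in at_right 0. \<forall>x\<in>(UNIV :: circle set). dist (exp (- (lam * t))) 1 < e" if "e > 0" for e
    using that by (auto dest: tendstoD)
qed

lemma exp_quotient_uniform_limit:
  "uniform_limit (UNIV :: circle set) (\<lambda>t _. (exp (- (lam * t)) - 1) / t) (\<lambda>_. - lam) (at_right 0)"
proof (rule uniform_limitI)
  have "((\<lambda>t. exp (- (lam * t))) has_real_derivative - lam) (at 0)"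
    by (auto intro!: derivative_eq_intros)
  then have "((\<lambda>t. (exp (- (lam * t)) - 1) / t) \<longlongrightarrow> - lam) (at_right 0)"
    unfolding has_field_derivative_iff by (auto intro: filterlim_at_within_If simp: filterlim_at_split)
  then show "\<forall>\<^sub>F t in at_right 0. \<forall>x\<in>(UNIV :: circle set). dist ((exp (- (lam * t)) - 1) / t) (- lam) < e"
    if "e > 0" for e
    using that by (auto dest: tendstoD)
qed

lemma PV_uniform_limit:
  assumes "continuous_on UNIV f"
  shows "uniform_limit UNIV (\<lambda>t. PV X Pr V lam F t f) f (at_right 0)"
proof -
  note Ff = Ff_continuous[OF assms]
  have one: "bounded (range (\<lambda>_ :: circle. 1 :: real))" by (simp add: image_constant_conv)
  have "uniform_limit UNIV (\<lambda>t x. exp (- (lam * t)) * FK t (\<lambda>y. F y * f y) x)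
      (\<lambda>x. 1 * (F x * f x)) (at_right 0)"
    by (rule uniform_lim_mult[OF exp_uniform_limit FK_uniform_limit[OF Ff] one circle_continuous_bounded_range[OF Ff]])
  from uniform_lim_mult[OF uniform_limit_const this
      circle_continuous_bounded_range[OF inverse_F_continuous]] circle_continuous_bounded_range[OF Ff]
  have "uniform_limit UNIV (\<lambda>t x. 1 / F x * (exp (- (lam * t)) * FK t (\<lambda>y. F y * f y) x))
      (\<lambda>x. 1 / F x * (1 * (F x * f x))) (at_right 0)"
    by simp
  then show ?thesis
    unfolding PV_eq[abs_def] using F_nz by simp
qed

text \<open>With g = F f, the product rule in time reads exp(-lam t) T_t g - g = exp(-lam t) (T_t g
  - g) + (exp(-lam t) - 1) g. Divided by t, this tends to (L+V) g - lam g, and division by F gives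
  \<open>LV\<close>.\<close>

lemma PV_generator:
  assumes "f \<in> C2_circle"
  shows "uniform_limit UNIV (\<lambda>t x. (PV X Pr V lam F t f x - f x) / t) (LV V lam F f) (at_right 0)"
proof -
  define g where "g = (\<lambda>y. F y * f y)"
  have gC2: "g \<in> C2_circle" unfolding g_def by (rule C2_circle_mult(1)[OF F_C2 assms])
  note gc = C2_circle_continuous[OF gC2]
  have "continuous_on UNIV (schroedinger V g)"
    unfolding schroedinger_def[abs_def] by (intro continuous_intros genL_continuous gC2 V_continuous gc)
  note Sb = circle_continuous_bounded_range[OF this]
  have one: "bounded (range (\<lambda>_ :: circle. c :: real))" for c by (simp add: image_constant_conv)
  have 1: "uniform_limit UNIV (\<lambda>t x. exp (- (lam * t)) * ((FK t g x - g x) / t))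
      (\<lambda>x. 1 * schroedinger V g x) (at_right 0)"
    by (rule uniform_lim_mult[OF exp_uniform_limit FK_generator[OF gC2] one Sb])
  have 2: "uniform_limit UNIV (\<lambda>t x. (exp (- (lam * t)) - 1) / t * g x)
      (\<lambda>x. - lam * g x) (at_right 0)"
    by (rule uniform_lim_mult[OF exp_quotient_uniform_limit uniform_limit_const one
          circle_continuous_bounded_range[OF gc]])
  \<comment> \<open>Products of uniform limits converge uniformly because the limit functions are
    bounded.\<close>
  have lb: "bounded (range (\<lambda>x. 1 * schroedinger V g x + - lam * g x))"
    by (rule circle_continuous_bounded_range)
       (auto simp: schroedinger_def intro!: continuous_intros genL_continuous gC2 V_continuous gc)
  have 3: "uniform_limit UNIV (\<lambda>t x. 1 / F x * (exp (- (lam * t)) * ((FK t g x - g x) / t)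
        + (exp (- (lam * t)) - 1) / t * g x))
      (\<lambda>x. 1 / F x * (1 * schroedinger V g x + - lam * g x)) (at_right 0)"
    by (rule uniform_lim_mult[OF uniform_limit_const uniform_limit_add[OF 1 2]
          circle_continuous_bounded_range[OF inverse_F_continuous] lb])
  have "1 / F x * (exp (- (lam * t)) * ((FK t g x - g x) / t) + (exp (- (lam * t)) - 1) / t * g x)
      = (PV X Pr V lam F t f x - f x) / t" for t x
  proof -
    have "1 / F x * (exp (- (lam * t)) * ((FK t g x - g x) / t) + (exp (- (lam * t)) - 1) / t * g x)
        = (exp (- (lam * t)) / F x * FK t g x - g x / F x) / t"
      by (simp add: algebra_simps diff_divide_distrib)
    then show ?thesis unfolding PV_eq g_def using F_nz by simp
  qed
  moreover have "1 / F x * (1 * schroedinger V g x + - lam * g x) = LV V lam F f x" for x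
    unfolding LV_def g_def using F_nz[of x] by (simp add: algebra_simps)
  ultimately show ?thesis using 3 by simp
qed

lemma PV_C_semigroup: "C_semigroup (PV X Pr V lam F)"
  unfolding C_semigroup_def
  using PV_continuous PV_linear PV_bounded PV_0 PV_add PV_uniform_limit by blast

end

end

theorem proposition1p1:
  fixes V F :: "circle \<Rightarrow> real" and lam :: real
    and \<Omega> :: "'w set" and \<F> :: "real \<Rightarrow> 'w measure"
    and X :: "real \<Rightarrow> 'w \<Rightarrow> circle" and Pr :: "circle \<Rightarrow> 'w measure"
  assumes "circle_brownian_motion \<Omega> \<F> X Pr"
    and "\<exists>C. C-lipschitz_on UNIV V"
    and "is_largest_eigenvalue V lam"
    and "is_eigenfunction V lam F"
    and "\<forall>x. F x > 0"
  shows "(\<forall>f\<in>C2_circle. \<forall>x. LV V lam F f x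
            = 1 / 2 * circle_deriv (circle_deriv f) x
              + circle_deriv (\<lambda>y. ln (F y)) x * circle_deriv f x) \<and>
         C_semigroup (PV X Pr V lam F) \<and>
         has_generator (PV X Pr V lam F) (LV V lam F)"
proof -
  interpret circle_brownian_motion \<Omega> \<F> X Pr by (rule assms(1))
  interpret feynman_kac \<Omega> \<F> X Pr V
    by unfold_locales (use assms(2) lipschitz_on_continuous_on in blast)
  have F: "F \<in> C2_circle" using assms(4) by (simp add: is_eigenfunction_def)
  have pos: "F x > 0" for x using assms(5) by blast
  show ?thesis
    using LV_eq[OF assms(4) pos] PV_C_semigroup[OF F pos] PV_generator[OF F pos]
    unfolding has_generator_def by blast
qed

end
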